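(* The FVEM mass matrix $M$ on a simplicial mesh is symmetric positive definite and its spectral condition number satisfies $$\frac{|\omega_{\max}|}{|\omega_{\min}|}\le\kappa(M)\le\frac{1}{(d+1)(m_1-m_2)}\,\frac{|\omega_{\max}|}{|\omega_{\min}|},$$ where $|\omega_{\max}|=\max_{1\le i\le N_{vi}}|\omega_i|$ and $|\omega_{\min}|=\min_{1\le i\le N_{vi}}|\omega_i|$.
   Context: $\mathcal{T}_h$ is a simplicial mesh of a bounded polyhedral domain $\Omega\subset\mathbb{R}^d$ with interior vertices $P_1,\dots,P_{N_{vi}}$ and continuous piecewise linear nodal basis functions $\phi_j$. Dual mesh: for an element $K$ with barycentric coordinates $\lambda$, $K^*_P\cap K=\{x\in K:\lambda_P\ge\lambda_Q\ \forall Q\}$, $K^*_P$ their union. FVEM mass matrix $M=(M_{ij})_{i,j=1}^{N_{vi}}$, $M_{ij}=\int_{K^*_{P_i}}\phi_j\,dx$. $\omega_i$ is the patch of elements containing $P_i$, $|\omega_i|$ its volume. $m_1=\frac{1}{(d+1)^3}\big(1+(d+1)\sum_{k=1}^d\frac1k\big)$, $m_2=\frac{1}{d(d+1)^3}\big(d^2+2d-(d+1)\sum_{k=1}^d\frac1k\big)$. $\kappa(M)=\lambda_{\max}(M)/\lambda_{\min}(M)$. *)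

theory Defs
  imports "HOL-Analysis.Analysis"
begin

text \<open>A simplicial mesh in the space 'a (dimension d = DIM('a)) is a finite nonempty set
of elements; each element is given by its set of d+1 affinely independent vertices
and is the convex hull of them. Elements meet face-to-face (conformity).\<close>

definition simplicial_mesh :: "'a::euclidean_space set set \<Rightarrow> bool" where
  "simplicial_mesh T \<longleftrightarrow> finite T \<and> T \<noteq> {} \<and>
     (\<forall>K\<in>T. finite K \<and> card K = DIM('a) + 1 \<and> \<not> affine_dependent K) \<and>
     (\<forall>K\<in>T. \<forall>K'\<in>T. convex hull K \<inter> convex hull K' = convex hull (K \<inter> K'))"

definition mesh_domain :: "'a::euclidean_space set set \<Rightarrow> 'a set" where
  "mesh_domain T = interior (\<Union>K\<in>T. convex hull K)"

definition interior_vertices :: "'a::euclidean_space set set \<Rightarrow> 'a set" where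
  "interior_vertices T = {P \<in> \<Union>T. P \<in> mesh_domain T}"

definition bary :: "'a::euclidean_space set \<Rightarrow> 'a \<Rightarrow> 'a \<Rightarrow> real" where
  "bary K P x = (THE u. (\<forall>v. v \<notin> K \<longrightarrow> u v = 0) \<and> sum u K = 1 \<and>
                         (\<Sum>v\<in>K. u v *\<^sub>R v) = x) P"

definition hat_fun :: "'a::euclidean_space set set \<Rightarrow> 'a \<Rightarrow> 'a \<Rightarrow> real" where
  "hat_fun T P x =
     (if \<exists>K\<in>T. P \<in> K \<and> x \<in> convex hull K
      then bary (SOME K. K \<in> T \<and> P \<in> K \<and> x \<in> convex hull K) P x else 0)"

definition dual_cell :: "'a::euclidean_space set set \<Rightarrow> 'a \<Rightarrow> 'a set" where
  "dual_cell T P = (\<Union>K\<in>{K\<in>T. P \<in> K}.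
      {x \<in> convex hull K. \<forall>Q\<in>K. bary K Q x \<le> bary K P x})"

definition patch :: "'a::euclidean_space set set \<Rightarrow> 'a \<Rightarrow> 'a set" where
  "patch T P = (\<Union>K\<in>{K\<in>T. P \<in> K}. convex hull K)"

text \<open>FVEM mass matrix entries, indexed by interior vertices.\<close>
definition fvem_mass :: "'a::euclidean_space set set \<Rightarrow> 'a \<Rightarrow> 'a \<Rightarrow> real" where
  "fvem_mass T P Q = integral (dual_cell T P) (hat_fun T Q)"

text \<open>Matrices indexed by a finite set I, represented as functions I x I -> real;
vectors as functions I -> real.\<close>
definition sym_mat :: "'i set \<Rightarrow> ('i \<Rightarrow> 'i \<Rightarrow> real) \<Rightarrow> bool" where
  "sym_mat I M \<longleftrightarrow> (\<forall>i\<in>I. \<forall>j\<in>I. M i j = M j i)"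

definition pos_def_mat :: "'i set \<Rightarrow> ('i \<Rightarrow> 'i \<Rightarrow> real) \<Rightarrow> bool" where
  "pos_def_mat I M \<longleftrightarrow> (\<forall>v. (\<exists>i\<in>I. v i \<noteq> 0) \<longrightarrow> (\<Sum>i\<in>I. \<Sum>j\<in>I. v i * M i j * v j) > 0)"

definition mat_eigenvalues :: "'i set \<Rightarrow> ('i \<Rightarrow> 'i \<Rightarrow> real) \<Rightarrow> real set" where
  "mat_eigenvalues I M = {l. \<exists>v. (\<exists>i\<in>I. v i \<noteq> 0) \<and>
                              (\<forall>i\<in>I. (\<Sum>j\<in>I. M i j * v j) = l * v i)}"

definition cond_number :: "'i set \<Rightarrow> ('i \<Rightarrow> 'i \<Rightarrow> real) \<Rightarrow> real" where
  "cond_number I M = Max (mat_eigenvalues I M) / Min (mat_eigenvalues I M)"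

definition m1_const :: "nat \<Rightarrow> real" where
  "m1_const d = (1 + real (d+1) * (\<Sum>k=1..d. 1 / real k)) / real (d+1) ^ 3"

definition m2_const :: "nat \<Rightarrow> real" where
  "m2_const d = (real d ^ 2 + 2 * real d - real (d+1) * (\<Sum>k=1..d. 1 / real k))
                  / (real d * real (d+1) ^ 3)"

end

theory Submission
  imports Defs
begin

text \<open>On a simplex with volume \<open>V\<close> and \<open>n = d + 1\<close> vertices, let \<open>E(S)\<close> be the integral of the
  largest barycentric coordinate over a vertex set \<open>S\<close> with \<open>s\<close> elements. The simplex splits into
  the regions where \<open>Q \<in> S\<close> has the smallest coordinate in \<open>S\<close>; each is the image of the whole
  simplex under the affine map that moves \<open>Q\<close> to the barycentre of \<open>S\<close>, under which the maximum
  over \<open>S\<close> becomes the maximum over \<open>S - {Q}\<close> plus \<open>1/s\<close> times the coordinate of \<open>Q\<close>. Hence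
  \<open>E(S) = E(S - {Q}) + V/(n s)\<close>, that is \<open>E(S) = V H\<^sub>s / n\<close> with harmonic numbers \<open>H\<^sub>s\<close>. Taking
  \<open>S\<close> to be the full vertex set and using the symmetry of the simplex gives the local mass matrix
  \<open>V ((m\<^sub>1 - m\<^sub>2) \<delta>\<^sub>P\<^sub>Q + m\<^sub>2)\<close>.

  Summing over the elements, the quadratic form of \<open>M\<close> lies between \<open>m\<^sub>1 - m\<^sub>2\<close> and
  \<open>m\<^sub>1 + d m\<^sub>2 = 1/n\<close> times the sum of \<open>|\<omega>\<^sub>P| v\<^sub>P\<^sup>2\<close>, which bounds the condition number from above.
  The lower bound compares the extreme eigenvalues with the diagonal entries \<open>m\<^sub>1 |\<omega>\<^sub>P|\<close>.\<close>

section \<open>Affine change of variables\<close>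

text \<open>Uniqueness of Haar measure: integrate \<open>g(x) h(x + y)\<close> in both orders, where \<open>g\<close> is the
  indicator of the unit ball.\<close>

lemma translation_invariant_nn_integral:
  fixes \<mu> :: "'a::euclidean_space measure"
  assumes sets[measurable_cong]: "sets \<mu> = sets borel" and sf: "sigma_finite_measure \<mu>"
    and inv: "\<And>t. distr \<mu> borel (\<lambda>x. t + x) = \<mu>"
    and h[measurable]: "h \<in> borel_measurable borel"
  shows "emeasure lborel (ball (0::'a) 1) * (\<integral>\<^sup>+x. h x \<partial>\<mu>) = emeasure \<mu> (ball 0 1) * (\<integral>\<^sup>+x. h x \<partial>lborel)"
proof -
  interpret m: sigma_finite_measure \<mu> by fact
  interpret p: pair_sigma_finite lborel \<mu> ..
  define g where "g = (indicator (ball (0::'a) 1) :: 'a \<Rightarrow> ennreal)"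
  have g[measurable]: "g \<in> borel_measurable borel"
    unfolding g_def by (rule borel_measurable_indicator) simp
  have g_uminus: "g (- x) = g x" for x by (simp add: g_def indicator_def)
  have sp: "sets (lborel \<Otimes>\<^sub>M \<mu>) = sets (borel \<Otimes>\<^sub>M borel)"
    by (rule sets_pair_measure_cong) (simp_all add: sets)
  have gl: "(\<integral>\<^sup>+x. g x \<partial>lborel) = emeasure lborel (ball (0::'a) 1)"
    and gm: "(\<integral>\<^sup>+x. g x \<partial>\<mu>) = emeasure \<mu> (ball (0::'a) 1)"
    unfolding g_def by (simp_all add: sets)
  have "emeasure lborel (ball (0::'a) 1) * (\<integral>\<^sup>+y. h y \<partial>\<mu>) = (\<integral>\<^sup>+x. g x * (\<integral>\<^sup>+y. h y \<partial>\<mu>) \<partial>lborel)"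
    by (subst nn_integral_multc) (simp_all add: gl)
  also have "\<dots> = (\<integral>\<^sup>+x. (\<integral>\<^sup>+y. g x * h (x + y) \<partial>\<mu>) \<partial>lborel)"
  proof (rule nn_integral_cong)
    fix x :: 'a
    have "(\<integral>\<^sup>+y. h y \<partial>\<mu>) = (\<integral>\<^sup>+y. h y \<partial>distr \<mu> borel (\<lambda>y. x + y))"
      by (simp only: inv)
    also have "\<dots> = (\<integral>\<^sup>+y. h (x + y) \<partial>\<mu>)"
      by (rule nn_integral_distr) measurable
    finally show "g x * (\<integral>\<^sup>+y. h y \<partial>\<mu>) = (\<integral>\<^sup>+y. g x * h (x + y) \<partial>\<mu>)"
      by (simp add: nn_integral_cmult)
  qed
  also have "\<dots> = (\<integral>\<^sup>+y. (\<integral>\<^sup>+x. g x * h (x + y) \<partial>lborel) \<partial>\<mu>)"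
    by (rule p.Fubini'[symmetric]) (unfold measurable_cong_sets[OF sp refl], measurable)
  \<comment> \<open>Invariance of \<open>lborel\<close> moves the shift from \<open>h\<close> to
    \<open>g\<close>, so that after the second exchange of integrals \<open>h x\<close> is constant
    in the inner variable.\<close>
  also have "\<dots> = (\<integral>\<^sup>+y. (\<integral>\<^sup>+x. g (x - y) * h x \<partial>lborel) \<partial>\<mu>)"
  proof (rule nn_integral_cong)
    fix y :: 'a
    have "(\<integral>\<^sup>+x. g (x - y) * h x \<partial>lborel) = (\<integral>\<^sup>+x. g (x - y) * h x \<partial>distr lborel borel (\<lambda>x. y + x))"
      by (simp only: lborel_distr_plus)
    also have "\<dots> = (\<integral>\<^sup>+x. g (y + x - y) * h (y + x) \<partial>lborel)"
      by (rule nn_integral_distr) measurable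
    finally show "(\<integral>\<^sup>+x. g x * h (x + y) \<partial>lborel) = (\<integral>\<^sup>+x. g (x - y) * h x \<partial>lborel)"
      by (simp add: add.commute)
  qed
  also have "\<dots> = (\<integral>\<^sup>+x. (\<integral>\<^sup>+y. g (x - y) * h x \<partial>\<mu>) \<partial>lborel)"
    by (rule p.Fubini') (unfold measurable_cong_sets[OF sp refl], measurable)
  also have "\<dots> = (\<integral>\<^sup>+x. emeasure \<mu> (ball 0 1) * h x \<partial>lborel)"
  proof (rule nn_integral_cong)
    fix x :: 'a
    \<comment> \<open>Shifting \<open>y\<close> by \<open>x\<close> leaves \<open>g (- y)\<close>,
      and the ball is symmetric about the origin.\<close>
    have "(\<integral>\<^sup>+y. g (x - y) \<partial>\<mu>) = (\<integral>\<^sup>+y. g (x - y) \<partial>distr \<mu> borel (\<lambda>y. x + y))"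
      by (simp only: inv)
    also have "\<dots> = (\<integral>\<^sup>+y. g (x - (x + y)) \<partial>\<mu>)"
      by (rule nn_integral_distr) measurable
    also have "\<dots> = (\<integral>\<^sup>+y. g y \<partial>\<mu>)" 
      by (simp add: g_uminus)
    also have "\<dots> = emeasure \<mu> (ball 0 1)" by (rule gm)
    finally show "(\<integral>\<^sup>+y. g (x - y) * h x \<partial>\<mu>) = emeasure \<mu> (ball 0 1) * h x"
      by (subst nn_integral_multc) auto
  qed
  also have "\<dots> = emeasure \<mu> (ball 0 1) * (\<integral>\<^sup>+x. h x \<partial>lborel)"
    by (rule nn_integral_cmult) measurable
  finally show ?thesis .
qed

text \<open>The image measure is again translation invariant, because shifting by \<open>t\<close>
  after the map equals shifting by the preimage of \<open>t\<close> under \<open>L\<close> before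
  it. Uniqueness of Haar measure then makes it a multiple of Lebesgue measure. The factor stays
  abstract and no determinant is computed; what matters is that it is positive and finite.\<close>

lemma distr_lborel_affine_bij:
  fixes L :: "'a::euclidean_space \<Rightarrow> 'a"
  assumes L: "linear L" "inj L"
  shows "\<exists>k>0. distr lborel borel (\<lambda>x. a + L x) = density lborel (\<lambda>_. ennreal k)"
proof -
  obtain L' where L': "linear L'" "\<And>x. L' (L x) = x" "\<And>x. L (L' x) = x"
    using linear_injective_isomorphism[OF L] by blast
  let ?f = "\<lambda>x. a + L x"
  let ?\<mu> = "distr lborel borel ?f"
  have contL: "continuous_on A L" for A using L(1) by (simp add: linear_continuous_on linear_linear)
  have [measurable]: "?f \<in> borel_measurable borel"
    by (intro borel_measurable_continuous_onI continuous_intros contL)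
  \<comment> \<open>Preimages of balls are images of balls under the inverse affine map. Their
    boundedness gives sigma-finiteness of the image measure; openness and nonemptiness give the unit
    ball positive mass, hence \<open>k > 0\<close>.\<close>
  have vim: "?f -` ball 0 r = (\<lambda>y. L' (y - a)) ` ball 0 r" for r
  proof safe
    fix x assume "a + L x \<in> ball 0 r"
    then show "x \<in> (\<lambda>y. L' (y - a)) ` ball 0 r"
      by (intro image_eqI[of _ _ "a + L x"]) (auto simp: L')
  qed (auto simp: L')
  have bdd: "bounded (?f -` ball 0 r)" for r
  proof -
    have "(\<lambda>y. L' (y - a)) ` ball 0 r = L' ` ((\<lambda>y. y - a) ` ball 0 r)" by (simp add: image_image)
    moreover have "bounded ((\<lambda>y. y - a) ` ball 0 r)"
      using bounded_translation_minus bounded_ball by blast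
    ultimately show ?thesis
      unfolding vim using bounded_linear_image linear_conv_bounded_linear L'(1) by metis
  qed
  have opn: "open (?f -` ball 0 r)" for r
    by (intro continuous_open_vimage open_ball) (auto intro!: continuous_intros contL[of UNIV, unfolded continuous_on_eq_continuous_at[OF open_UNIV], rule_format])
  have em: "emeasure ?\<mu> (ball 0 r) = emeasure lborel (?f -` ball 0 r)" for r
    by (simp add: emeasure_distr)
  have fin: "emeasure ?\<mu> (ball 0 r) < \<infinity>" for r
    unfolding em by (rule emeasure_bounded_finite[OF bdd])
  have sf: "sigma_finite_measure ?\<mu>"
  proof
    show "\<exists>A::'a set set. countable A \<and> A \<subseteq> sets ?\<mu> \<and> \<Union>A = space ?\<mu> \<and> (\<forall>a\<in>A. emeasure ?\<mu> a \<noteq> \<infinity>)"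
      using fin by (intro exI[of _ "range (\<lambda>n::nat. ball 0 (real n))"])
        (auto simp: less_top intro: reals_Archimedean2)
  qed
  have inv: "distr ?\<mu> borel (\<lambda>x. t + x) = ?\<mu>" for t
  proof -
    have "distr ?\<mu> borel (\<lambda>x. t + x) = distr lborel borel (\<lambda>x. t + ?f x)"
      by (subst distr_distr) (auto simp: comp_def)
    also have "(\<lambda>x. t + ?f x) = (\<lambda>x. ?f (L' t + x))"
      using L(1) by (auto simp: linear_add L')
    also have "distr lborel borel (\<lambda>x. ?f (L' t + x)) = distr (distr lborel borel (\<lambda>x. L' t + x)) borel ?f"
      by (subst distr_distr) (auto simp: comp_def)
    finally show ?thesis by (simp add: lborel_distr_plus)
  qed
  let ?b = "measure lborel (ball (0::'a) 1)"
  let ?m = "measure ?\<mu> (ball 0 1)"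
  have b: "emeasure lborel (ball (0::'a) 1) = ennreal ?b" "?b > 0"
    using emeasure_bounded_finite[of "ball (0::'a) 1"]
    by (auto simp: emeasure_eq_ennreal_measure less_top content_ball_pos)
  have m: "emeasure ?\<mu> (ball 0 1) = ennreal ?m"
    using fin[of 1] by (simp add: emeasure_eq_ennreal_measure less_top)
  have "L' (0 - a) \<in> ?f -` ball 0 1" unfolding vim by (rule imageI) simp
  then have "?f -` ball 0 1 \<noteq> {}" by blast
  then have "\<not> negligible (?f -` ball 0 1)" by (rule open_not_negligible[OF opn])
  then have "emeasure ?\<mu> (ball 0 1) \<noteq> 0"
    unfolding em using opn[of 1]
    by (simp add: negligible_iff_null_sets null_sets_def)
  then have "?m \<noteq> 0" unfolding m by auto
  then have mpos: "?m > 0" by (simp add: zero_less_measure_iff)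
  have "?\<mu> = density lborel (\<lambda>_. ennreal (?m / ?b))"
  proof (rule measure_eqI)
    fix A assume "A \<in> sets ?\<mu>"
    then have A[measurable]: "A \<in> sets borel" by simp
    have "ennreal ?b * emeasure ?\<mu> A = ennreal ?m * emeasure lborel A"
      using translation_invariant_nn_integral[OF _ sf inv, of "indicator A"] A unfolding b m
      by (simp add: nn_integral_indicator)
    then have "ennreal (1/?b) * (ennreal ?b * emeasure ?\<mu> A) = ennreal (1/?b) * (ennreal ?m * emeasure lborel A)"
      by simp
    then have "emeasure ?\<mu> A = ennreal (?m / ?b) * emeasure lborel A"
      using b(2) by (simp add: mult.assoc[symmetric] ennreal_mult[symmetric])
    then show "emeasure ?\<mu> A = emeasure (density lborel (\<lambda>_. ennreal (?m / ?b))) A"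
      by (simp add: emeasure_density_const)
  qed simp
  then show ?thesis using mpos b(2) by (intro exI[of _ "?m / ?b"]) auto
qed

text \<open>Passes from the gauge integral that defines \<open>fvem_mass\<close> to the Lebesgue
  integral, for which image measures are available.\<close>

lemma integral_compact_eq_lborel:
  fixes g :: "'a::euclidean_space \<Rightarrow> real"
  assumes "compact S" "continuous_on S g"
  shows "integral S g = (LINT x|lborel. indicator S x * g x)"
  using borel_integrable_compact[OF assms] set_borel_integral_eq_integral(2)[of S g]
  by (simp add: set_integrable_def set_lebesgue_integral_def)

text \<open>The order of quantifiers matters: one constant serves all \<open>S\<close> and
  \<open>g\<close>, so it can later be found or eliminated by testing with the constant function
  1.\<close>

lemma integral_affine_bij_image:
  fixes L :: "'a::euclidean_space \<Rightarrow> 'a"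
  assumes L: "linear L" "inj L"
  shows "\<exists>c>0. \<forall>S (g::'a \<Rightarrow> real). compact S \<longrightarrow> continuous_on ((\<lambda>x. a + L x) ` S) g \<longrightarrow>
            integral ((\<lambda>x. a + L x) ` S) g = c * integral S (\<lambda>x. g (a + L x))"
proof -
  let ?f = "\<lambda>x. a + L x"
  obtain k where k: "k > 0" "distr lborel borel ?f = density lborel (\<lambda>_. ennreal k)"
    using distr_lborel_affine_bij[OF L, of a] by auto
  have contL: "continuous_on A L" for A using L(1) by (simp add: linear_continuous_on linear_linear)
  have cf: "continuous_on A ?f" for A by (intro continuous_intros contL)
  have [measurable]: "?f \<in> borel_measurable borel"
    by (rule borel_measurable_continuous_onI[OF cf])
  have "integral (?f ` S) g = (1/k) * integral S (\<lambda>x. g (?f x))"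
    if S: "compact S" and g: "continuous_on (?f ` S) g" for S and g :: "'a \<Rightarrow> real"
  proof -
    have cS: "compact (?f ` S)" using S cf by (rule compact_continuous_image[rotated])
    have [measurable]: "(\<lambda>x. indicator (?f ` S) x * g x) \<in> borel_measurable borel"
      using borel_measurable_continuous_on_indicator[of "?f ` S" g] cS g by (simp add: borel_compact)
    have "integral S (\<lambda>x. g (?f x)) = (LINT x|lborel. indicator S x * g (?f x))"
      by (rule integral_compact_eq_lborel[OF S]) (rule continuous_on_compose2[OF g cf], auto)
    \<comment> \<open>By injectivity the integrand becomes a function of \<open>?f x\<close> alone,
      as the image measure requires.\<close>
    also have "\<dots> = (LINT x|lborel. indicator (?f ` S) (?f x) * g (?f x))"
    proof -
      have "?f x \<in> ?f ` S \<longleftrightarrow> x \<in> S" for x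
        by (rule inj_image_mem_iff) (use L(2) in \<open>simp add: inj_def\<close>)
      then show ?thesis by (simp only: indicator_def)
    qed
    also have "\<dots> = (LINT x|distr lborel borel ?f. indicator (?f ` S) x * g x)"
      by (rule integral_distr[symmetric]) measurable
    also have "\<dots> = k * (LINT x|lborel. indicator (?f ` S) x * g x)"
      unfolding k(2) using k(1) by (subst integral_density) auto
    also have "\<dots> = k * integral (?f ` S) g"
      by (simp add: integral_compact_eq_lborel[OF cS g])
    finally show ?thesis using k(1) by simp
  qed
  then show ?thesis using k(1) by (intro exI[of _ "1/k"]) auto
qed

section \<open>Barycentric coordinates\<close>

locale full_simplex =
  fixes K :: "'a::euclidean_space set"
  assumes finite_K: "finite K" and card_K: "card K = DIM('a) + 1" and indep: "\<not> affine_dependent K"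
begin

lemma affine_combination_unique:
  assumes "sum u K = sum w K" "(\<Sum>v\<in>K. u v *\<^sub>R v) = (\<Sum>v\<in>K. w v *\<^sub>R v)" "v \<in> K"
  shows "u v = w v"
proof (rule ccontr)
  assume "u v \<noteq> w v"
  then have "\<exists>U. sum U K = 0 \<and> (\<exists>v\<in>K. U v \<noteq> 0) \<and> (\<Sum>v\<in>K. U v *\<^sub>R v) = 0"
    using assms by (intro exI[of _ "\<lambda>v. u v - w v"]) (auto simp: sum_subtractf scaleR_left_diff_distrib)
  then show False
    using indep affine_dependent_explicit_finite[OF finite_K] by blast
qed

text \<open>Since \<open>d + 1\<close> affinely independent points span the whole space affinely,
  coordinates exist for every \<open>x\<close>, also outside the simplex. Fixing the weights to 0
  off \<open>K\<close> makes the weight function unique, so the definite description in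
  \<open>bary\<close> is meaningful.\<close>

lemma bary_props:
  "(\<forall>v. v \<notin> K \<longrightarrow> bary K v x = 0) \<and> (\<Sum>v\<in>K. bary K v x) = 1 \<and> (\<Sum>v\<in>K. bary K v x *\<^sub>R v) = x"
proof -
  let ?P = "\<lambda>u. (\<forall>v. v \<notin> K \<longrightarrow> u v = 0) \<and> sum u K = 1 \<and> (\<Sum>v\<in>K. u v *\<^sub>R v) = x"
  have "x \<in> affine hull K"
    using affine_independent_span_eq[OF indep] card_K by simp
  then obtain u where u: "sum u K = 1" "(\<Sum>v\<in>K. u v *\<^sub>R v) = x"
    by (auto simp: affine_hull_finite[OF finite_K])
  have "\<exists>!u. ?P u"
  proof (rule ex1I)
    show "?P (\<lambda>v. if v \<in> K then u v else 0)" using u by (simp cong: sum.cong)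
    fix w assume w: "?P w"
    show "w = (\<lambda>v. if v \<in> K then u v else 0)"
      using affine_combination_unique[of w u] u w by auto
  qed
  from theI'[OF this] show ?thesis by (simp add: bary_def)
qed

lemma bary_outside: "v \<notin> K \<Longrightarrow> bary K v x = 0"
  and sum_bary: "(\<Sum>v\<in>K. bary K v x) = 1"
  and bary_combination: "(\<Sum>v\<in>K. bary K v x *\<^sub>R v) = x"
  using bary_props by auto

lemma bary_unique:
  assumes "sum u K = 1" "(\<Sum>v\<in>K. u v *\<^sub>R v) = x" "v \<in> K"
  shows "bary K v x = u v"
  using affine_combination_unique[of "\<lambda>v. bary K v x" u v] assms sum_bary bary_combination by simp

lemma bary_inject: "(\<And>v. v \<in> K \<Longrightarrow> bary K v x = bary K v y) \<Longrightarrow> x = y"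
  by (subst bary_combination[of x, symmetric], subst bary_combination[of y, symmetric])
    (simp cong: sum.cong)

lemma mem_hull_iff: "x \<in> convex hull K \<longleftrightarrow> (\<forall>v\<in>K. 0 \<le> bary K v x)"
proof
  assume "x \<in> convex hull K"
  then obtain u where u: "\<forall>v\<in>K. 0 \<le> u v" "sum u K = 1" "(\<Sum>v\<in>K. u v *\<^sub>R v) = x"
    by (auto simp: convex_hull_finite[OF finite_K])
  then show "\<forall>v\<in>K. 0 \<le> bary K v x" using bary_unique[OF u(2,3)] by simp
next
  assume "\<forall>v\<in>K. 0 \<le> bary K v x"
  then show "x \<in> convex hull K"
    using sum_bary bary_combination unfolding convex_hull_finite[OF finite_K]
    by (intro CollectI exI[of _ "\<lambda>v. bary K v x"]) auto
qed

lemma bary_vertex: "v \<in> K \<Longrightarrow> w \<in> K \<Longrightarrow> bary K v w = (if v = w then 1 else 0)"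
proof (rule bary_unique)
  assume "w \<in> K"
  then show "(\<Sum>v\<in>K. if v = w then 1 else 0::real) = 1" "(\<Sum>v\<in>K. (if v = w then 1 else 0::real) *\<^sub>R v) = w"
    using finite_K by (simp_all add: if_distrib[of "\<lambda>c. c *\<^sub>R _"] cong: if_cong)
qed

definition bary_lin :: "'a \<Rightarrow> 'a \<Rightarrow> real" where
  "bary_lin v x = bary K v x - bary K v 0"

lemma bary_eq: "bary K v x = bary K v 0 + bary_lin v x"
  by (simp add: bary_lin_def)

lemma linear_bary_lin: "linear (bary_lin v)"
proof (cases "v \<in> K")
  case True
  show ?thesis
  proof (rule linearI)
    fix x y :: 'a
    have "bary K v (x + y) = bary K v x + bary K v y - bary K v 0"
      by (rule bary_unique[OF _ _ True])
        (simp_all add: sum.distrib sum_subtractf sum_bary scaleR_left_distrib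
          scaleR_left_diff_distrib bary_combination)
    then show "bary_lin v (x + y) = bary_lin v x + bary_lin v y" by (simp add: bary_lin_def)
  next
    fix c :: real and x :: 'a
    have "bary K v (c *\<^sub>R x) = c * bary K v x + (1 - c) * bary K v 0"
      by (rule bary_unique[OF _ _ True])
        (simp_all add: sum.distrib scaleR_left_distrib sum_bary bary_combination flip: sum_distrib_left scaleR_scaleR scaleR_sum_right)
    then show "bary_lin v (c *\<^sub>R x) = c *\<^sub>R bary_lin v x"
      by (simp add: bary_lin_def algebra_simps)
  qed
next
  case False
  then show ?thesis by (simp add: bary_lin_def bary_outside[OF False] linear_iff)
qed

lemma continuous_on_bary[continuous_intros]: "continuous_on A (bary K v)"
proof -
  have "continuous_on A (\<lambda>x. bary K v 0 + bary_lin v x)"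
    by (intro continuous_intros linear_continuous_on) (simp add: linear_bary_lin linear_linear)
  then show ?thesis by (simp flip: bary_eq)
qed

text \<open>The affine self-map of the space that sends each vertex \<open>v\<close> to
  \<open>w v\<close>.\<close>

definition vertex_map :: "('a \<Rightarrow> 'a) \<Rightarrow> 'a \<Rightarrow> 'a" where
  "vertex_map w x = (\<Sum>v\<in>K. bary K v x *\<^sub>R w v)"

lemma integral_vertex_map_image:
  assumes inj: "inj (vertex_map w)"
  shows "\<exists>c>0. \<forall>S (g::'a \<Rightarrow> real). compact S \<longrightarrow> continuous_on (vertex_map w ` S) g \<longrightarrow>
        integral (vertex_map w ` S) g = c * integral S (\<lambda>x. g (vertex_map w x))"
proof -
  let ?L = "\<lambda>x. \<Sum>v\<in>K. bary_lin v x *\<^sub>R w v"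
  have eq: "vertex_map w = (\<lambda>x. vertex_map w 0 + ?L x)"
  proof
    fix x
    show "vertex_map w x = vertex_map w 0 + ?L x"
      unfolding vertex_map_def by (subst bary_eq) (simp add: scaleR_left_distrib sum.distrib)
  qed
  have L: "linear ?L"
    by (rule linearI)
      (simp_all add: linear_add[OF linear_bary_lin] linear_scale[OF linear_bary_lin]
        scaleR_left_distrib sum.distrib scaleR_sum_right)
  have "inj ?L"
  proof (rule injI)
    fix x y assume "?L x = ?L y"
    then have "vertex_map w x = vertex_map w y" using eq by metis
    then show "x = y" using inj by (simp add: inj_eq)
  qed
  from integral_affine_bij_image[OF L this, of "vertex_map w 0"] show ?thesis
    by (simp only: eq[THEN fun_cong, symmetric] eq[symmetric])
qed

text \<open>The points \<open>y\<close> and \<open>z\<close> certify that the affine function is not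
  constant, so its level sets are hyperplanes.\<close>

lemma negligible_bary_affine:
  assumes "\<And>x. f x = a + (\<Sum>v\<in>K. c v * bary K v x)" "f y \<noteq> f z"
  shows "negligible {x. f x = b}"
proof -
  let ?l = "\<lambda>x. \<Sum>v\<in>K. c v * bary_lin v x"
  have l: "linear ?l"
    by (rule linearI)
      (simp_all add: linear_add[OF linear_bary_lin] linear_scale[OF linear_bary_lin]
        distrib_left sum.distrib sum_distrib_left mult.left_commute)
  have f: "f x = f 0 + ?l x" for x
    unfolding assms(1) by (subst bary_eq) (simp add: distrib_left sum.distrib)
  \<comment> \<open>The gradient of \<open>f\<close>, that is, the vector representing its linear
    part as an inner product.\<close>
  define d where "d = (\<Sum>b\<in>Basis. ?l b *\<^sub>R b)"
  have ld: "?l x = d \<bullet> x" for x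
  proof -
    have "?l x = ?l (\<Sum>b\<in>Basis. (x \<bullet> b) *\<^sub>R b)" by (simp only: euclidean_representation)
    also have "\<dots> = (\<Sum>b\<in>Basis. (x \<bullet> b) * ?l b)"
      unfolding linear_sum[OF l] linear_scale[OF l] by simp
    also have "\<dots> = d \<bullet> x" by (simp add: d_def inner_sum_left inner_commute[of x] mult.commute)
    finally show ?thesis .
  qed
  have "d \<noteq> 0" using assms(2) f[of y] f[of z] ld by auto
  moreover have "f x = b \<longleftrightarrow> d \<bullet> x = b - f 0" for x using f[of x] ld[of x] by linarith
  ultimately show ?thesis by (simp add: negligible_hyperplane)
qed

lemma negligible_bary_eq:
  assumes "P \<in> K" "Q \<in> K" "P \<noteq> Q"
  shows "negligible {x. bary K P x = bary K Q x}"
proof -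
  have "negligible {x. bary K P x - bary K Q x = 0}"
  \<comment> \<open>The difference of the two coordinates is 1 at \<open>P\<close> and -1 at
    \<open>Q\<close>, so it is not constant.\<close>
  proof (rule negligible_bary_affine[where a = 0 and c = "\<lambda>v. (if v = P then 1 else 0) - (if v = Q then 1 else 0)" and y = P and z = Q])
    show "bary K P x - bary K Q x = 0 + (\<Sum>v\<in>K. ((if v = P then 1 else 0) - (if v = Q then 1 else 0)) * bary K v x)" for x
      using assms finite_K by (simp add: left_diff_distrib sum_subtractf if_distrib[of "\<lambda>c. c * _"] cong: if_cong)
  qed (use assms in \<open>simp add: bary_vertex\<close>)
  then show ?thesis by simp
qed

lemma card_K_gt_1: "card K > 1"
  using card_K DIM_positive[where 'a='a] by simp

lemma negligible_bary_zero:
  assumes "P \<in> K"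
  shows "negligible {x. bary K P x = 0}"
proof -
  have "\<not> K \<subseteq> {P}" using card_K_gt_1 card_mono[of "{P}" K] by auto
  then obtain Q where "Q \<in> K" "Q \<noteq> P" by blast
  then show ?thesis
    by (intro negligible_bary_affine[where a = 0 and c = "\<lambda>v. if v = P then 1 else 0" and y = P and z = Q])
      (use assms finite_K in \<open>simp_all add: bary_vertex if_distrib[of "\<lambda>c. c * _"] cong: if_cong\<close>)
qed

end

section \<open>Integrals over a simplex\<close>

lemma integral_UN_negligible:
  fixes f :: "'a::euclidean_space \<Rightarrow> real"
  assumes "finite I" "\<And>i. i \<in> I \<Longrightarrow> f integrable_on C i"
    and "\<And>i j. i \<in> I \<Longrightarrow> j \<in> I \<Longrightarrow> i \<noteq> j \<Longrightarrow> negligible (C i \<inter> C j)"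
  shows "integral (\<Union>i\<in>I. C i) f = (\<Sum>i\<in>I. integral (C i) f)"
  by (intro integral_unique has_integral_UN) (use assms in \<open>auto simp: pairwise_def integrable_integral\<close>)

lemma integrable_continuous_compact:
  fixes f :: "'a::euclidean_space \<Rightarrow> real"
  assumes "compact S" "continuous_on S f"
  shows "f integrable_on S"
  using borel_integrable_compact[OF assms] set_borel_integral_eq_integral(1)[of S f]
  by (simp add: set_integrable_def)

context full_simplex
begin

abbreviation vol :: real where "vol \<equiv> measure lebesgue (convex hull K)"

lemma compact_hull: "compact (convex hull K)"
  using finite_K by (simp add: finite_imp_compact_convex_hull)

lemma integral_one_hull: "integral (convex hull K) (\<lambda>x. 1) = vol"
  by (rule lmeasure_integral[symmetric]) (rule lmeasurable_compact[OF compact_hull])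

lemma vol_pos: "vol > 0"
proof -
  have "interior (convex hull K) \<noteq> {}"
    using interior_convex_hull_eq_empty[of K] card_K indep by simp
  then have "\<not> negligible (interior (convex hull K))" by (intro open_not_negligible) auto
  then have "\<not> negligible (convex hull K)" using negligible_subset interior_subset by blast
  then show ?thesis
    using lmeasurable_compact[OF compact_hull]
    by (simp add: negligible_iff_measure zero_less_measure_iff)
qed

section \<open>Symmetries of a simplex induced by involutions of its vertices\<close>

lemma bary_vertex_map_involution:
  assumes \<pi>: "\<And>v. v \<in> K \<Longrightarrow> \<pi> v \<in> K" "\<And>v. v \<in> K \<Longrightarrow> \<pi> (\<pi> v) = v" and "u \<in> K"
  shows "bary K u (vertex_map \<pi> x) = bary K (\<pi> u) x"
proof (rule bary_unique[OF _ _ \<open>u \<in> K\<close>])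
  have bij: "bij_betw \<pi> K K" by (rule bij_betwI[of _ _ _ \<pi>]) (use \<pi> in auto)
  show "(\<Sum>v\<in>K. bary K (\<pi> v) x) = 1"
    using sum.reindex_bij_betw[OF bij, of "\<lambda>v. bary K v x"] sum_bary by simp
  have "vertex_map \<pi> x = (\<Sum>v\<in>K. bary K (\<pi> v) x *\<^sub>R \<pi> (\<pi> v))"
    unfolding vertex_map_def
    using sum.reindex_bij_betw[OF bij, of "\<lambda>v. bary K v x *\<^sub>R \<pi> v"] by simp
  then show "(\<Sum>v\<in>K. bary K (\<pi> v) x *\<^sub>R v) = vertex_map \<pi> x" using \<pi>(2) by simp
qed

lemma vertex_map_involution:
  assumes \<pi>: "\<And>v. v \<in> K \<Longrightarrow> \<pi> v \<in> K" "\<And>v. v \<in> K \<Longrightarrow> \<pi> (\<pi> v) = v"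
  shows "vertex_map \<pi> (vertex_map \<pi> x) = x"
  by (rule bary_inject) (simp add: bary_vertex_map_involution \<pi>)

lemma involution_image_hull:
  assumes \<pi>: "\<And>v. v \<in> K \<Longrightarrow> \<pi> v \<in> K" "\<And>v. v \<in> K \<Longrightarrow> \<pi> (\<pi> v) = v"
  shows "vertex_map \<pi> ` (convex hull K) = convex hull K"
proof -
  have sub: "vertex_map \<pi> x \<in> convex hull K" if "x \<in> convex hull K" for x
    using that by (simp add: mem_hull_iff bary_vertex_map_involution \<pi>)
  show ?thesis
  proof (intro equalityI subsetI)
    fix x assume "x \<in> convex hull K"
    then show "x \<in> vertex_map \<pi> ` (convex hull K)"
      using vertex_map_involution[OF \<pi>, of x] sub[of x] by (metis imageI)
  qed (use sub in auto)
qed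

text \<open>The map carries the simplex onto itself, so testing with the function 1 on the simplex
  yields \<open>vol = c * vol\<close>, and positivity of the volume forces the Jacobian factor to be
  1.\<close>

lemma integral_involution_image:
  assumes \<pi>: "\<And>v. v \<in> K \<Longrightarrow> \<pi> v \<in> K" "\<And>v. v \<in> K \<Longrightarrow> \<pi> (\<pi> v) = v"
    and "compact S" "continuous_on (vertex_map \<pi> ` S) (g::'a \<Rightarrow> real)"
  shows "integral (vertex_map \<pi> ` S) g = integral S (\<lambda>x. g (vertex_map \<pi> x))"
proof -
  have "inj (vertex_map \<pi>)" by (rule inj_on_inverseI) (rule vertex_map_involution[OF \<pi>])
  from integral_vertex_map_image[OF this] obtain c where
    c: "\<forall>S (g::'a \<Rightarrow> real). compact S \<longrightarrow> continuous_on (vertex_map \<pi> ` S) g \<longrightarrow>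
        integral (vertex_map \<pi> ` S) g = c * integral S (\<lambda>x. g (vertex_map \<pi> x))"
    by blast
  have "vol = c * vol"
    using c[rule_format, OF compact_hull, of "\<lambda>_. 1"] by (simp add: integral_one_hull involution_image_hull[OF \<pi>])
  then have "c = 1" using vol_pos by simp
  then show ?thesis using c assms by simp
qed

section \<open>Dual cells inside a single simplex\<close>

definition cell :: "'a \<Rightarrow> 'a set" where
  "cell P = {x \<in> convex hull K. \<forall>Q\<in>K. bary K Q x \<le> bary K P x}"

lemma compact_Collect_bary:
  assumes "\<And>Q. Q \<in> S \<Longrightarrow> continuous_on UNIV (f Q)" "\<And>Q. Q \<in> S \<Longrightarrow> continuous_on UNIV (g Q)"
  shows "compact {x \<in> convex hull K. \<forall>Q\<in>S. f Q x \<le> (g Q x::real)}"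
proof -
  have "{x \<in> convex hull K. \<forall>Q\<in>S. f Q x \<le> g Q x} = convex hull K \<inter> (\<Inter>Q\<in>S. {x. f Q x \<le> g Q x})" by auto
  also have "compact \<dots>"
    by (intro compact_Int_closed compact_hull closed_INT ballI closed_Collect_le assms)
  finally show ?thesis .
qed

lemma compact_cell: "compact (cell P)"
  unfolding cell_def by (intro compact_Collect_bary continuous_intros)

lemma cell_involution:
  assumes \<pi>: "\<And>v. v \<in> K \<Longrightarrow> \<pi> v \<in> K" "\<And>v. v \<in> K \<Longrightarrow> \<pi> (\<pi> v) = v" and P: "P \<in> K"
  shows "cell (\<pi> P) = vertex_map \<pi> ` cell P"
proof -
  have sub: "vertex_map \<pi> x \<in> cell (\<pi> P)" if "x \<in> cell P" "P \<in> K" for x P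
    using that by (simp add: cell_def mem_hull_iff bary_vertex_map_involution \<pi>)
  show ?thesis
  proof (intro equalityI subsetI)
    fix x assume "x \<in> cell (\<pi> P)"
    then have "vertex_map \<pi> x \<in> cell P" using sub[of x "\<pi> P"] \<pi> P by simp
    then show "x \<in> vertex_map \<pi> ` cell P"
      using vertex_map_involution[OF \<pi>, of x] by (metis imageI)
  qed (use sub P in auto)
qed

lemma integral_cell_involution:
  assumes \<pi>: "\<And>v. v \<in> K \<Longrightarrow> \<pi> v \<in> K" "\<And>v. v \<in> K \<Longrightarrow> \<pi> (\<pi> v) = v" and P: "P \<in> K" and Q: "Q \<in> K"
  shows "integral (cell (\<pi> P)) (bary K (\<pi> Q)) = integral (cell P) (bary K Q)"
  using integral_involution_image[OF \<pi> compact_cell, of P "bary K (\<pi> Q)"] Q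
  by (simp add: cell_involution[OF \<pi> P] continuous_on_bary bary_vertex_map_involution \<pi>)

lemma integral_bary_involution:
  assumes \<pi>: "\<And>v. v \<in> K \<Longrightarrow> \<pi> v \<in> K" "\<And>v. v \<in> K \<Longrightarrow> \<pi> (\<pi> v) = v" and Q: "Q \<in> K"
  shows "integral (convex hull K) (bary K (\<pi> Q)) = integral (convex hull K) (bary K Q)"
  using integral_involution_image[OF \<pi> compact_hull, of "bary K (\<pi> Q)"] Q
  by (simp add: involution_image_hull[OF \<pi>] continuous_on_bary bary_vertex_map_involution \<pi>)

lemma transpose_vertices:
  assumes "P \<in> K" "Q \<in> K" "v \<in> K"
  shows "Transposition.transpose P Q v \<in> K"
  using assms by (simp add: Transposition.transpose_def)

text \<open>Transpositions of vertices make the integrals of all coordinates equal, and they add up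
  to the volume because the coordinates sum to 1.\<close>

lemma integral_bary_hull:
  assumes "Q \<in> K"
  shows "integral (convex hull K) (bary K Q) = vol / card K"
proof -
  have eq: "integral (convex hull K) (bary K P) = integral (convex hull K) (bary K Q)" if "P \<in> K" for P
    using integral_bary_involution[of "Transposition.transpose P Q" Q] assms that
    by (simp add: transpose_vertices)
  have "vol = integral (convex hull K) (\<lambda>x. \<Sum>P\<in>K. bary K P x)"
    by (simp add: sum_bary integral_one_hull)
  also have "\<dots> = (\<Sum>P\<in>K. integral (convex hull K) (bary K P))"
    by (intro integral_sum finite_K integrable_continuous_compact compact_hull continuous_on_bary)
  also have "\<dots> = card K * integral (convex hull K) (bary K Q)" using eq by simp
  finally show ?thesis using card_K_gt_1 by (simp add: field_simps)
qed

section \<open>The integral of the largest coordinate over a vertex set\<close>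

definition max_bary :: "'a set \<Rightarrow> 'a \<Rightarrow> real" where
  "max_bary S x = Max ((\<lambda>v. bary K v x) ` S)"

definition min_region :: "'a set \<Rightarrow> 'a \<Rightarrow> 'a set" where
  "min_region S Q = {x \<in> convex hull K. \<forall>R\<in>S. bary K Q x \<le> bary K R x}"

lemma continuous_on_max_bary:
  assumes "finite S" "S \<noteq> {}"
  shows "continuous_on A (max_bary S)"
  using assms
proof (induction rule: finite_ne_induct)
  case (singleton v)
  then show ?case by (simp add: max_bary_def continuous_on_bary)
next
  case (insert v S)
  then have "max_bary (insert v S) = (\<lambda>x. max (bary K v x) (max_bary S x))"
    by (simp add: max_bary_def fun_eq_iff)
  then show ?case using insert by (simp add: continuous_on_max continuous_on_bary)
qed

lemma compact_min_region: "compact (min_region S Q)"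
  unfolding min_region_def by (intro compact_Collect_bary continuous_intros)

text \<open>The regions cover the simplex because a minimum over \<open>S\<close> is attained, and
  two of them overlap only where two coordinates agree, which is a null set.\<close>

lemma integral_min_regions:
  assumes S: "S \<subseteq> K" "S \<noteq> {}" and g: "continuous_on (convex hull K) (g :: 'a \<Rightarrow> real)"
  shows "integral (convex hull K) g = (\<Sum>Q\<in>S. integral (min_region S Q) g)"
proof -
  have fin: "finite S" using S finite_K finite_subset by blast
  have "(\<Union>Q\<in>S. min_region S Q) = convex hull K"
  proof (intro equalityI subsetI)
    fix x assume x: "x \<in> convex hull K"
    obtain Q where "Q \<in> S" "bary K Q x = Min ((\<lambda>v. bary K v x) ` S)"
      using Min_in[of "(\<lambda>v. bary K v x) ` S"] fin S by (metis (no_types, lifting) finite_imageI imageE image_is_empty)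
    then show "x \<in> (\<Union>Q\<in>S. min_region S Q)" using x fin by (auto simp: min_region_def intro!: bexI[of _ Q])
  qed (auto simp: min_region_def)
  moreover have "integral (\<Union>Q\<in>S. min_region S Q) g = (\<Sum>Q\<in>S. integral (min_region S Q) g)"
  proof (rule integral_UN_negligible[OF fin])
    fix Q
    show "g integrable_on min_region S Q"
      by (rule integrable_continuous_compact[OF compact_min_region continuous_on_subset[OF g]])
        (auto simp: min_region_def)
    fix R assume "Q \<in> S" "R \<in> S" "Q \<noteq> R"
    moreover from this have "min_region S Q \<inter> min_region S R \<subseteq> {x. bary K Q x = bary K R x}"
      by (auto simp: min_region_def intro: antisym)
    ultimately show "negligible (min_region S Q \<inter> min_region S R)"
      using negligible_bary_eq[of Q R] negligible_subset S by blast
  qed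
  ultimately show ?thesis by simp
qed

lemma integral_cells:
  assumes g: "continuous_on (convex hull K) (g :: 'a \<Rightarrow> real)"
  shows "integral (convex hull K) g = (\<Sum>Q\<in>K. integral (cell Q) g)"
proof -
  have ne: "K \<noteq> {}" using card_K by auto
  have "(\<Union>Q\<in>K. cell Q) = convex hull K"
  proof (intro equalityI subsetI)
    fix x assume x: "x \<in> convex hull K"
    obtain Q where "Q \<in> K" "bary K Q x = Max ((\<lambda>v. bary K v x) ` K)"
      using Max_in[of "(\<lambda>v. bary K v x) ` K"] finite_K ne by (metis (no_types, lifting) finite_imageI imageE image_is_empty)
    then show "x \<in> (\<Union>Q\<in>K. cell Q)" using x finite_K by (auto simp: cell_def intro!: bexI[of _ Q])
  qed (auto simp: cell_def)
  moreover have "integral (\<Union>Q\<in>K. cell Q) g = (\<Sum>Q\<in>K. integral (cell Q) g)"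
  proof (rule integral_UN_negligible[OF finite_K])
    fix Q
    show "g integrable_on cell Q"
      by (rule integrable_continuous_compact[OF compact_cell continuous_on_subset[OF g]])
        (auto simp: cell_def)
    fix R assume "Q \<in> K" "R \<in> K" "Q \<noteq> R"
    moreover from this have "cell Q \<inter> cell R \<subseteq> {x. bary K Q x = bary K R x}"
      by (auto simp: cell_def intro: antisym)
    ultimately show "negligible (cell Q \<inter> cell R)"
      using negligible_bary_eq[of Q R] negligible_subset by blast
  qed
  ultimately show ?thesis by simp
qed

definition bary_shift :: "'a set \<Rightarrow> 'a \<Rightarrow> 'a \<Rightarrow> 'a" where
  "bary_shift S Q v = (if v = Q then (1 / card S) *\<^sub>R (\<Sum>R\<in>S. R) else v)"

text \<open>Moving \<open>Q\<close> to the barycentre of \<open>S\<close> spreads the weight of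
  \<open>Q\<close> evenly over \<open>S\<close>, with \<open>Q\<close> itself keeping one share; all
  other weights stay in place.\<close>

lemma bary_bary_shift:
  assumes S: "S \<subseteq> K" "Q \<in> S" and u: "u \<in> K"
  shows "bary K u (vertex_map (bary_shift S Q) x) =
    (if u = Q then 0 else bary K u x) + (if u \<in> S then bary K Q x / card S else 0)"
proof (rule bary_unique[OF _ _ u])
  have QK: "Q \<in> K" and fin: "finite S" and KS: "K \<inter> S = S" using S finite_K finite_subset by auto
  have c: "real (card S) \<noteq> 0" using fin S by auto
  have 1: "(\<Sum>u\<in>K. if u = Q then 0 else bary K u x) = 1 - bary K Q x"
    using sum.remove[OF finite_K QK, of "\<lambda>u. bary K u x"] sum.remove[OF finite_K QK, of "\<lambda>u. if u = Q then 0 else bary K u x"]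
    by (simp add: sum_bary)
  have 2: "(\<Sum>u\<in>K. if u \<in> S then bary K Q x / card S else 0) = bary K Q x"
    using c by (simp add: sum.inter_restrict[OF finite_K, symmetric] KS)
  show "(\<Sum>u\<in>K. (if u = Q then 0 else bary K u x) + (if u \<in> S then bary K Q x / card S else 0)) = 1"
    using 1 2 by (simp add: sum.distrib)
  have 3: "(\<Sum>u\<in>K. (if u = Q then 0 else bary K u x) *\<^sub>R u) = (\<Sum>u\<in>K - {Q}. bary K u x *\<^sub>R u)"
    using sum.remove[OF finite_K QK, of "\<lambda>u. (if u = Q then 0 else bary K u x) *\<^sub>R u"] by simp
  have 4: "(\<Sum>u\<in>K. (if u \<in> S then bary K Q x / card S else 0) *\<^sub>R u) = (bary K Q x / card S) *\<^sub>R (\<Sum>u\<in>S. u)"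
  proof -
    have "(\<Sum>u\<in>K. (if u \<in> S then bary K Q x / card S else 0) *\<^sub>R u) = (\<Sum>u\<in>K. if u \<in> S then (bary K Q x / card S) *\<^sub>R u else 0)"
      by (intro sum.cong) auto
    also have "\<dots> = (\<Sum>u\<in>S. (bary K Q x / card S) *\<^sub>R u)"
      by (simp only: sum.inter_restrict[OF finite_K, symmetric] KS)
    finally show ?thesis by (simp add: scaleR_sum_right)
  qed
  have 5: "vertex_map (bary_shift S Q) x = (bary K Q x / card S) *\<^sub>R (\<Sum>u\<in>S. u) + (\<Sum>u\<in>K - {Q}. bary K u x *\<^sub>R u)"
    unfolding vertex_map_def sum.remove[OF finite_K QK]
    by (intro arg_cong2[of _ _ _ _ "(+)"] sum.cong) (auto simp: bary_shift_def)
  show "(\<Sum>u\<in>K. ((if u = Q then 0 else bary K u x) + (if u \<in> S then bary K Q x / card S else 0)) *\<^sub>R u) = vertex_map (bary_shift S Q) x"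
    unfolding scaleR_left_distrib sum.distrib 3 4 5 by simp
qed

lemma inj_bary_shift:
  assumes S: "S \<subseteq> K" "Q \<in> S"
  shows "inj (vertex_map (bary_shift S Q))"
proof (rule injI)
  fix x y assume eq: "vertex_map (bary_shift S Q) x = vertex_map (bary_shift S Q) y"
  have QK: "Q \<in> K" and fin: "finite S" using S finite_K finite_subset by auto
  have c: "real (card S) \<noteq> 0" using fin S by auto
  have "bary K Q x / card S = bary K Q y / card S"
    using bary_bary_shift[OF S QK, of x] bary_bary_shift[OF S QK, of y] S(2) unfolding eq by auto
  then have Q: "bary K Q x = bary K Q y" using c by simp
  show "x = y"
  proof (rule bary_inject)
    fix u assume u: "u \<in> K"
    show "bary K u x = bary K u y"
      using bary_bary_shift[OF S u, of x] bary_bary_shift[OF S u, of y] unfolding eq Q by (cases "u = Q") (auto simp: Q)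
  qed
qed

lemma bary_shift_image_hull:
  assumes S: "S \<subseteq> K" "Q \<in> S"
  shows "vertex_map (bary_shift S Q) ` (convex hull K) = min_region S Q"
proof (intro equalityI subsetI)
  have QK: "Q \<in> K" and fin: "finite S" and KS: "K \<inter> S = S" using S finite_K finite_subset by auto
  have c: "real (card S) > 0" using fin S by (auto simp: card_gt_0_iff)
  {
    fix y assume "y \<in> vertex_map (bary_shift S Q) ` (convex hull K)"
    then obtain x where x: "x \<in> convex hull K" and y: "y = vertex_map (bary_shift S Q) x" by auto
    have pos: "0 \<le> bary K u x" if "u \<in> K" for u using x that mem_hull_iff by auto
    have "0 \<le> bary K u y" if "u \<in> K" for u
      unfolding y bary_bary_shift[OF S that] using pos QK that c by auto
    \<comment> \<open>The image coordinate at \<open>Q\<close> is just the common share, which is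
      also a summand of every other image coordinate in \<open>S\<close>.\<close>
    moreover have "bary K Q y \<le> bary K R y" if "R \<in> S" for R
    proof -
      have RK: "R \<in> K" using that S by auto
      show ?thesis unfolding y bary_bary_shift[OF S RK] bary_bary_shift[OF S QK] using that S pos RK by auto
    qed
    ultimately show "y \<in> min_region S Q" by (simp add: min_region_def mem_hull_iff)
  }
  fix y assume "y \<in> min_region S Q"
  then have pos: "\<And>u. u \<in> K \<Longrightarrow> 0 \<le> bary K u y" and le: "\<And>R. R \<in> S \<Longrightarrow> bary K Q y \<le> bary K R y"
    by (auto simp: min_region_def mem_hull_iff)
  \<comment> \<open>The coordinates of the preimage: the vertex \<open>Q\<close> collects the
    \<open>card S\<close> equal shares and the other vertices of \<open>S\<close> give theirs back.
    Nonnegativity is exactly the condition that \<open>Q\<close> has the smallest coordinate in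
    \<open>S\<close>.\<close>
  define m where "m = (\<lambda>u. bary K u y - (if u \<in> S then bary K Q y else 0) + (if u = Q then card S * bary K Q y else 0))"
  have m1: "sum m K = 1"
    using QK finite_K unfolding m_def
    by (simp add: sum.distrib sum_subtractf sum_bary sum.inter_restrict[OF finite_K, symmetric] KS)
  define x where "x = (\<Sum>u\<in>K. m u *\<^sub>R u)"
  have bx: "bary K u x = m u" if "u \<in> K" for u by (rule bary_unique[OF m1 _ that]) (simp add: x_def)
  have "0 \<le> m u" if "u \<in> K" for u
    using pos[OF that] pos[OF QK] le[of u] S c unfolding m_def by auto
  then have "x \<in> convex hull K" by (simp add: mem_hull_iff bx)
  moreover have "vertex_map (bary_shift S Q) x = y"
  proof (rule bary_inject)
    fix u assume u: "u \<in> K"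
    have "m Q = card S * bary K Q y" using S by (simp add: m_def)
    then show "bary K u (vertex_map (bary_shift S Q) x) = bary K u y"
      unfolding bary_bary_shift[OF S u] bx[OF u] bx[OF QK] using c S by (auto simp: m_def)
  qed
  ultimately show "y \<in> vertex_map (bary_shift S Q) ` (convex hull K)" by blast
qed

text \<open>All coordinates in \<open>S\<close> receive the same share, which can be pulled out of
  the maximum. What remains at \<open>Q\<close> is 0, and this never exceeds the maximum over the
  nonempty rest because coordinates are nonnegative on the simplex.\<close>

lemma max_bary_bary_shift:
  assumes S: "S \<subseteq> K" "Q \<in> S" "S - {Q} \<noteq> {}" and x: "x \<in> convex hull K"
  shows "max_bary S (vertex_map (bary_shift S Q) x) = max_bary (S - {Q}) x + bary K Q x / card S"
proof -
  have QK: "Q \<in> K" and fin: "finite S" using S finite_K finite_subset by auto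
  have pos: "0 \<le> bary K u x" if "u \<in> K" for u using x that mem_hull_iff by auto
  have val: "bary K u (vertex_map (bary_shift S Q) x) = (if u = Q then 0 else bary K u x) + bary K Q x / card S" if "u \<in> S" for u
    using bary_bary_shift[OF S(1,2), of u x] that S by auto
  have le: "bary K u x \<le> max_bary (S - {Q}) x" if "u \<in> S - {Q}" for u
    unfolding max_bary_def using fin that by (intro Max_ge) auto
  have "max_bary (S - {Q}) x \<in> (\<lambda>v. bary K v x) ` (S - {Q})"
    unfolding max_bary_def using fin S by (intro Max_in) auto
  then obtain R where R: "R \<in> S" "R \<noteq> Q" "max_bary (S - {Q}) x = bary K R x" by auto
  have p: "0 \<le> max_bary (S - {Q}) x" using R pos S by auto
  show ?thesis
    unfolding max_bary_def[of S]
  proof (rule Max_eqI)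
    fix z assume "z \<in> (\<lambda>v. bary K v (vertex_map (bary_shift S Q) x)) ` S"
    then obtain u where u: "u \<in> S" "z = bary K u (vertex_map (bary_shift S Q) x)" by auto
    then show "z \<le> max_bary (S - {Q}) x + bary K Q x / card S"
      using val[OF u(1)] le[of u] p by (auto split: if_splits)
  next
    show "max_bary (S - {Q}) x + bary K Q x / card S \<in> (\<lambda>v. bary K v (vertex_map (bary_shift S Q) x)) ` S"
      using R val[OF R(1)] by (intro image_eqI[of _ _ R]) auto
  qed (use fin in auto)
qed

text \<open>Induction on the size of \<open>S\<close>, starting from singletons, where the maximum
  is a single coordinate. Removing one vertex contributes the next harmonic term.\<close>

lemma integral_max_bary:
  assumes "S \<subseteq> K" "card S = Suc m"
  shows "integral (convex hull K) (max_bary S) = vol / card K * (\<Sum>k=1..Suc m. 1 / k)"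
  using assms
proof (induction m arbitrary: S)
  case 0
  then obtain Q where "S = {Q}" "Q \<in> K" by (auto simp: card_1_singleton_iff)
  moreover have "max_bary {Q} = bary K Q" by (simp add: max_bary_def fun_eq_iff)
  ultimately show ?case by (simp add: integral_bary_hull)
next
  case (Suc m)
  have fin: "finite S" and ne: "S \<noteq> {}" using Suc.prems card.infinite by fastforce+
  let ?H = "\<Sum>k=1..Suc (Suc m). 1 / real k"
  \<comment> \<open>The same Jacobian factor \<open>c\<close> governs the integral of the maximum
    and the volume of the region; recording both allows the factors to be eliminated by summing over
    \<open>Q\<close>.\<close>
  have "\<exists>c. integral (min_region S Q) (max_bary S) = c * (vol / card K * ?H)
          \<and> integral (min_region S Q) (\<lambda>_. 1) = c * vol" if Q: "Q \<in> S" for Q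
  proof -
    have QK: "Q \<in> K" using Q Suc.prems by auto
    have cm: "card (S - {Q}) = Suc m" using Q Suc.prems by simp
    then have ne': "S - {Q} \<noteq> {}" by force
    obtain c where c: "\<forall>A (g::'a \<Rightarrow> real). compact A \<longrightarrow> continuous_on (vertex_map (bary_shift S Q) ` A) g \<longrightarrow>
        integral (vertex_map (bary_shift S Q) ` A) g = c * integral A (\<lambda>x. g (vertex_map (bary_shift S Q) x))"
      using integral_vertex_map_image[OF inj_bary_shift[OF Suc.prems(1) Q]] by blast
    have im: "vertex_map (bary_shift S Q) ` (convex hull K) = min_region S Q"
      by (rule bary_shift_image_hull[OF Suc.prems(1) Q])
    have "integral (min_region S Q) (max_bary S) = c * integral (convex hull K) (\<lambda>x. max_bary S (vertex_map (bary_shift S Q) x))"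
      using c[rule_format, OF compact_hull, of "max_bary S"] im continuous_on_max_bary[OF fin ne] by simp
    also have "integral (convex hull K) (\<lambda>x. max_bary S (vertex_map (bary_shift S Q) x))
        = integral (convex hull K) (\<lambda>x. max_bary (S - {Q}) x + bary K Q x / card S)"
      by (intro integral_cong max_bary_bary_shift[OF Suc.prems(1) Q ne'])
    also have "\<dots> = integral (convex hull K) (max_bary (S - {Q})) + integral (convex hull K) (\<lambda>x. bary K Q x / card S)"
      by (intro integral_add integrable_continuous_compact compact_hull continuous_on_max_bary continuous_intros)
        (use fin ne' Suc.prems in auto)
    also have "integral (convex hull K) (\<lambda>x. bary K Q x / card S) = vol / card K / card S"
      by (simp add: integral_bary_hull[OF QK])
    also have "integral (convex hull K) (max_bary (S - {Q})) = vol / card K * (\<Sum>k=1..Suc m. 1 / k)"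
      by (rule Suc.IH) (use Suc.prems cm in auto)
    also have "vol / card K * (\<Sum>k=1..Suc m. 1 / real k) + vol / card K / card S = vol / card K * ?H"
      using Suc.prems by (simp add: distrib_left)
    finally have 1: "integral (min_region S Q) (max_bary S) = c * (vol / card K * ?H)" .
    have "integral (min_region S Q) (\<lambda>_. 1) = c * vol"
      using c[rule_format, OF compact_hull, of "\<lambda>_. 1"] im by (simp add: integral_one_hull)
    with 1 show ?thesis by blast
  qed
  then obtain c where
    c1: "\<And>Q. Q \<in> S \<Longrightarrow> integral (min_region S Q) (max_bary S) = c Q * (vol / card K * ?H)" and
    c2: "\<And>Q. Q \<in> S \<Longrightarrow> integral (min_region S Q) (\<lambda>_. 1) = c Q * vol"
    by metis
  \<comment> \<open>The regions partition the simplex up to null sets, so the factors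
    \<open>c Q\<close> add up to 1; their individual values never enter.\<close>
  have "vol = (\<Sum>Q\<in>S. integral (min_region S Q) (\<lambda>_. 1))"
    using integral_min_regions[OF Suc.prems(1) ne, of "\<lambda>_. 1"] by (simp add: integral_one_hull)
  also have "\<dots> = (\<Sum>Q\<in>S. c Q) * vol" by (simp add: c2 sum_distrib_right)
  finally have sc: "(\<Sum>Q\<in>S. c Q) = 1" using vol_pos by simp
  have "integral (convex hull K) (max_bary S) = (\<Sum>Q\<in>S. integral (min_region S Q) (max_bary S))"
    by (rule integral_min_regions[OF Suc.prems(1) ne continuous_on_max_bary[OF fin ne]])
  also have "\<dots> = (\<Sum>Q\<in>S. c Q) * (vol / card K * ?H)" unfolding sum_distrib_right by (intro sum.cong c1) auto
  finally show ?case unfolding sc by simp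
qed

section \<open>Entries of the local mass matrix\<close>

lemma integral_cell_diag:
  assumes P: "P \<in> K"
  shows "integral (cell P) (bary K P) = m1_const DIM('a) * vol"
proof -
  have eq: "integral (cell Q) (bary K Q) = integral (cell P) (bary K P)" if "Q \<in> K" for Q
    using integral_cell_involution[of "Transposition.transpose P Q" P P] P that
    by (simp add: transpose_vertices)
  have ne: "K \<noteq> {}" using P by auto
  \<comment> \<open>On the cell of \<open>Q\<close> the maximum over all vertices is the coordinate
    of \<open>Q\<close>. The integral of the maximum is therefore \<open>card K\<close> times one
    diagonal entry, since by symmetry all diagonal entries agree.\<close>
  have "vol / card K * (\<Sum>k=1..Suc DIM('a). 1 / k) = integral (convex hull K) (max_bary K)"
    by (rule integral_max_bary[symmetric]) (simp_all add: card_K)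
  also have "\<dots> = (\<Sum>Q\<in>K. integral (cell Q) (max_bary K))"
    by (rule integral_cells[OF continuous_on_max_bary[OF finite_K ne]])
  also have "\<dots> = (\<Sum>Q\<in>K. integral (cell Q) (bary K Q))"
  proof (intro sum.cong refl integral_cong)
    fix Q x assume "Q \<in> K" "x \<in> cell Q"
    then show "max_bary K x = bary K Q x"
      unfolding max_bary_def cell_def using finite_K by (intro Max_eqI) auto
  qed
  also have "\<dots> = card K * integral (cell P) (bary K P)" using eq by simp
  finally have *: "vol / card K * (\<Sum>k=1..Suc DIM('a). 1 / k) = card K * integral (cell P) (bary K P)" .
  \<comment> \<open>The harmonic sum runs to \<open>d + 1\<close>, while \<open>m1_const\<close>
    uses the sum up to \<open>d\<close>; the last term \<open>1 / n\<close> is split off to match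
    it.\<close>
  define n where "n = real DIM('a) + 1"
  define H where "H = (\<Sum>k=1..DIM('a). 1 / real k)"
  have n: "n \<noteq> 0" by (simp add: n_def add_nonneg_eq_0_iff)
  have "vol / n * (H + 1 / n) = n * integral (cell P) (bary K P)"
    using * by (simp add: card_K n_def H_def add.commute)
  then have "integral (cell P) (bary K P) = vol / n * (H + 1 / n) / n" using n by (simp add: field_simps)
  also have "\<dots> = (1 + n * H) / n ^ 3 * vol" using n by (simp add: field_simps power3_eq_cube)
  finally show ?thesis by (simp add: m1_const_def n_def H_def add.commute)
qed

lemma integral_one_cell:
  assumes P: "P \<in> K"
  shows "integral (cell P) (\<lambda>_. 1) = vol / card K"
proof -
  have eq: "integral (cell Q) (\<lambda>_. 1) = integral (cell P) (\<lambda>_. 1::real)" if "Q \<in> K" for Q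
    using integral_involution_image[of "Transposition.transpose P Q" "cell P" "\<lambda>_. 1"]
      cell_involution[of "Transposition.transpose P Q" P] P that
    by (simp add: transpose_vertices compact_cell)
  have "vol = (\<Sum>Q\<in>K. integral (cell Q) (\<lambda>_. 1))"
    using integral_cells[of "\<lambda>_. 1"] by (simp add: integral_one_hull)
  also have "\<dots> = card K * integral (cell P) (\<lambda>_. 1)" using eq by simp
  finally show ?thesis using card_K_gt_1 by (simp add: field_simps)
qed

text \<open>Transpositions of two vertices other than \<open>P\<close> preserve the cell of
  \<open>P\<close>, so all \<open>d\<close> off-diagonal entries of its row agree. The row sums to
  the volume of the cell, and subtracting the diagonal entry determines them.\<close>

lemma integral_cell_offdiag:
  assumes P: "P \<in> K" and Q: "Q \<in> K" "Q \<noteq> P"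
  shows "integral (cell P) (bary K Q) = m2_const DIM('a) * vol"
proof -
  have eq: "integral (cell P) (bary K R) = integral (cell P) (bary K Q)" if "R \<in> K" "R \<noteq> P" for R
    using integral_cell_involution[of "Transposition.transpose Q R" P Q] P Q that
    by (simp add: transpose_vertices Transposition.transpose_apply_other)
  have d: "real DIM('a) > 0" by simp
  have "vol / card K = integral (cell P) (\<lambda>x. \<Sum>R\<in>K. bary K R x)"
    by (simp add: sum_bary integral_one_cell[OF P])
  also have "\<dots> = (\<Sum>R\<in>K. integral (cell P) (bary K R))"
    by (intro integral_sum finite_K integrable_continuous_compact compact_cell continuous_on_bary)
  also have "\<dots> = m1_const DIM('a) * vol + (\<Sum>R\<in>K-{P}. integral (cell P) (bary K R))"
    using P finite_K by (simp add: sum.remove integral_cell_diag)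
  also have "(\<Sum>R\<in>K-{P}. integral (cell P) (bary K R)) = (\<Sum>R\<in>K-{P}. integral (cell P) (bary K Q))"
    by (intro sum.cong refl eq) auto
  also have "\<dots> = real DIM('a) * integral (cell P) (bary K Q)"
    using P finite_K card_K by simp
  finally have *: "integral (cell P) (bary K Q) = (vol / card K - m1_const DIM('a) * vol) / DIM('a)"
    using d by (simp add: field_simps)
  have "(1 / real (card K) - m1_const DIM('a)) / DIM('a) = m2_const DIM('a)"
  proof -
    define n where "n = real DIM('a)"
    define H where "H = (\<Sum>k=1..DIM('a). 1 / real k)"
    have n: "n > 0" "n + 1 \<noteq> 0" using d n_def by auto
    have "(1 / (n + 1) - (1 + (n + 1) * H) / (n + 1) ^ 3) / n = (n\<^sup>2 + 2 * n - (n + 1) * H) / (n * (n + 1) ^ 3)"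
    proof -
      have "1 / (n + 1) = (n + 1)\<^sup>2 / (n + 1) ^ 3" using n by (simp add: power2_eq_square power3_eq_cube)
      then show ?thesis using n by (simp add: diff_divide_distrib[symmetric] power2_eq_square algebra_simps)
    qed
    then show ?thesis
      by (simp add: m1_const_def m2_const_def card_K n_def H_def add.commute)
  qed
  moreover have "(vol / card K - m1_const DIM('a) * vol) / DIM('a)
      = (1 / real (card K) - m1_const DIM('a)) / DIM('a) * vol"
    by (simp add: left_diff_distrib diff_divide_distrib)
  ultimately show ?thesis unfolding * by simp
qed

end

section \<open>Eigenvalues of symmetric matrices\<close>

text \<open>The first-order condition at a maximum, stated without derivatives.\<close>

lemma quadratic_nonpos_imp_linear_zero:
  fixes a b :: real
  assumes "\<And>t. 2 * t * a + t\<^sup>2 * b \<le> 0"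
  shows "a = 0"
proof (rule ccontr)
  assume a: "a \<noteq> 0"
  \<comment> \<open>With this step size \<open>t\<^sup>2 * (\<bar>b\<bar> + 1)\<close> equals
    \<open>t * a\<close>, so the quadratic term cannot cancel the linear one.\<close>
  define t where "t = a / (\<bar>b\<bar> + 1)"
  have p: "\<bar>b\<bar> + 1 > 0" by simp
  have ta: "t * a > 0" using a p by (auto simp: t_def zero_less_divide_iff zero_less_mult_iff linorder_neq_iff)
  have "t\<^sup>2 * \<bar>b\<bar> \<le> t\<^sup>2 * (\<bar>b\<bar> + 1)" by (simp add: mult_left_mono)
  also have "\<dots> = t * a" using p by (simp add: t_def power2_eq_square)
  finally have "- (t * a) \<le> t\<^sup>2 * b" using abs_ge_minus_self[of b] mult_left_mono[of "- b" "\<bar>b\<bar>" "t\<^sup>2"] by simp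
  then show False using assms[of t] ta by (simp add: mult.assoc)
qed

section \<open>Quadratic forms and the maximum of the Rayleigh quotient\<close>

definition quad_form :: "'i set \<Rightarrow> ('i \<Rightarrow> 'i \<Rightarrow> real) \<Rightarrow> ('i \<Rightarrow> real) \<Rightarrow> real" where
  "quad_form I M v = (\<Sum>i\<in>I. \<Sum>j\<in>I. v i * M i j * v j)"

text \<open>Vectors are functions on the whole index type, fixed to 0 off \<open>I\<close>. The
  sphere is then a closed subset of a product of compact intervals and points, which is compact by
  Tychonoff.\<close>

lemma compact_unit_sphere_fun:
  fixes I :: "'i set"
  assumes "finite I"
  shows "compact {v. (\<forall>i. i \<notin> I \<longrightarrow> v i = 0) \<and> (\<Sum>i\<in>I. (v i)\<^sup>2) = (1::real)}"
proof -
  let ?B = "PiE UNIV (\<lambda>i. if i \<in> I then {-1..1} else {0::real})"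
  have "compactin (product_topology (\<lambda>i. euclidean) UNIV) ?B"
    by (subst compactin_PiE) (auto simp: compactin_euclidean_iff)
  then have "compact ?B"
    by (simp add: euclidean_product_topology compactin_euclidean_iff)
  moreover have "closed {v::'i \<Rightarrow> real. (\<Sum>i\<in>I. (v i)\<^sup>2) = 1}"
    by (intro closed_Collect_eq continuous_intros continuous_on_product_coordinates)
  ultimately have "compact (?B \<inter> {v. (\<Sum>i\<in>I. (v i)\<^sup>2) = 1})" by (rule compact_Int_closed)
  also have "?B \<inter> {v. (\<Sum>i\<in>I. (v i)\<^sup>2) = 1} = {v. (\<forall>i. i \<notin> I \<longrightarrow> v i = 0) \<and> (\<Sum>i\<in>I. (v i)\<^sup>2) = 1}"
  proof -
    have B: "v \<in> ?B \<longleftrightarrow> (\<forall>i\<in>I. \<bar>v i\<bar> \<le> 1) \<and> (\<forall>i. i \<notin> I \<longrightarrow> v i = 0)" for v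
      unfolding PiE_iff by (auto simp: abs_le_iff split: if_splits)
    have "\<bar>v i\<bar> \<le> 1" if "(\<Sum>i\<in>I. (v i)\<^sup>2) = (1::real)" "i \<in> I" for v i
      using member_le_sum[of i I "\<lambda>i. (v i)\<^sup>2"] assms that by (simp add: abs_square_le_1)
    then show ?thesis unfolding set_eq_iff Int_iff mem_Collect_eq B by blast
  qed
  finally show ?thesis .
qed

lemma quad_form_add:
  assumes sym: "sym_mat I M"
  shows "quad_form I M (\<lambda>i. v i + t * w i) =
    quad_form I M v + 2 * t * (\<Sum>i\<in>I. w i * (\<Sum>j\<in>I. M i j * v j)) + t\<^sup>2 * quad_form I M w"
proof -
  have c: "(\<Sum>i\<in>I. \<Sum>j\<in>I. v i * M i j * w j) = (\<Sum>i\<in>I. \<Sum>j\<in>I. w i * M i j * v j)"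
    by (subst sum.swap) (use sym in \<open>auto simp: sym_mat_def intro!: sum.cong\<close>)
  have "quad_form I M (\<lambda>i. v i + t * w i) = (\<Sum>i\<in>I. \<Sum>j\<in>I. v i * M i j * v j + t * (v i * M i j * w j)
      + t * (w i * M i j * v j) + t\<^sup>2 * (w i * M i j * w j))"
    unfolding quad_form_def by (intro sum.cong refl) (simp add: algebra_simps power2_eq_square)
  also have "\<dots> = quad_form I M v + t * (\<Sum>i\<in>I. \<Sum>j\<in>I. v i * M i j * w j)
      + t * (\<Sum>i\<in>I. \<Sum>j\<in>I. w i * M i j * v j) + t\<^sup>2 * quad_form I M w"
    unfolding quad_form_def by (simp add: sum.distrib sum_distrib_left)
  also have "(\<Sum>i\<in>I. \<Sum>j\<in>I. w i * M i j * v j) = (\<Sum>i\<in>I. w i * (\<Sum>j\<in>I. M i j * v j))"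
    by (simp add: sum_distrib_left mult.assoc)
  finally show ?thesis unfolding c by (simp add: sum_distrib_left mult.assoc)
qed

lemma quad_form_scale: "quad_form I M (\<lambda>i. c * v i) = c\<^sup>2 * quad_form I M v"
  unfolding quad_form_def by (simp add: sum_distrib_left power2_eq_square ac_simps)

lemma quad_form_unit:
  assumes "finite I" "k \<in> I"
  shows "quad_form I M (\<lambda>i. if i = k then 1 else 0) = M k k"
proof -
  have "(\<Sum>j\<in>I. (if i = k then 1 else 0) * M i j * (if j = k then 1 else 0)) = (if i = k then M i k else 0)" for i
    using assms sum.delta[of I k "\<lambda>j. M i j"] by (simp add: if_distrib[of "\<lambda>c. _ * c"] cong: if_cong)
  then show ?thesis unfolding quad_form_def using assms by simp
qed

text \<open>A maximiser of the quadratic form on the unit sphere is an eigenvector with the maximum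
  as eigenvalue, and \<open>M k k\<close> is the value of the form at the \<open>k\<close>-th unit
  vector.\<close>

lemma ex_eigenvalue_ge_diag:
  assumes fin: "finite I" and sym: "sym_mat I M" and k: "k \<in> I"
  shows "\<exists>l\<in>mat_eigenvalues I M. M k k \<le> l"
proof -
  let ?S = "{v. (\<forall>i. i \<notin> I \<longrightarrow> v i = 0) \<and> (\<Sum>i\<in>I. (v i)\<^sup>2) = (1::real)}"
  have sq_unit: "(\<Sum>i\<in>I. (if i = k then 1 else 0::real)\<^sup>2) = 1" if "k \<in> I" for k
    using fin that by (simp add: if_distrib[of "\<lambda>c. c\<^sup>2"] cong: if_cong)
  have e: "(\<lambda>i. if i = k then 1 else 0) \<in> ?S" using k sq_unit by auto
  have "continuous_on ?S (quad_form I M)"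
    unfolding quad_form_def by (intro continuous_intros continuous_on_subset[OF continuous_on_product_coordinates subset_UNIV])
  then obtain v where v: "v \<in> ?S" and max: "\<And>w. w \<in> ?S \<Longrightarrow> quad_form I M w \<le> quad_form I M v"
    using continuous_attains_sup[OF compact_unit_sphere_fun[OF fin]] e by (metis (no_types, lifting) empty_iff)
  define l where "l = quad_form I M v"
  \<comment> \<open>Homogeneity extends the bound from the sphere to all vectors, so perturbations
    of \<open>v\<close> below do not have to be normalised. Vectors are first cut off outside
    \<open>I\<close> to lie in \<open>?S\<close>.\<close>
  have rayleigh: "quad_form I M w \<le> l * (\<Sum>i\<in>I. (w i)\<^sup>2)" for w
  proof (cases "\<forall>i\<in>I. w i = 0")
    case True
    then show ?thesis by (simp add: quad_form_def)
  next
    case False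
    define s where "s = (\<Sum>i\<in>I. (w i)\<^sup>2)"
    have s: "s > 0" unfolding s_def using False fin by (metis (no_types, lifting) sum_pos2 zero_le_power2 zero_less_power2)
    let ?w = "\<lambda>i. (if i \<in> I then w i else 0)"
    have "(\<lambda>i. (1 / sqrt s) * ?w i) \<in> ?S"
      using s by (simp add: power_mult_distrib power_divide flip: sum_divide_distrib s_def)
    from max[OF this] have "quad_form I M (\<lambda>i. (1 / sqrt s) * ?w i) \<le> l" by (simp add: l_def)
    then have "(1 / sqrt s)\<^sup>2 * quad_form I M ?w \<le> l" by (simp only: quad_form_scale)
    moreover have "quad_form I M ?w = quad_form I M w" by (simp add: quad_form_def cong: sum.cong)
    ultimately show ?thesis using s by (simp add: power_divide field_simps flip: s_def)
  qed
  have "(\<Sum>j\<in>I. M i j * v j) = l * v i" if i: "i \<in> I" for i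
  proof -
    let ?e = "\<lambda>j. if j = i then 1 else 0 :: real"
    let ?A = "(\<Sum>j\<in>I. M i j * v j)"
    have A: "(\<Sum>j\<in>I. ?e j * (\<Sum>m\<in>I. M j m * v m)) = ?A"
      using fin i by (simp add: if_distrib[of "\<lambda>c. c * _"] cong: if_cong)
    \<comment> \<open>First variation at \<open>v\<close> in the direction of the
      \<open>i\<close>-th unit vector: the Rayleigh bound, with the value \<open>l\<close> at
      \<open>v\<close> cancelled on both sides.\<close>
    have "2 * t * (?A - l * v i) + t\<^sup>2 * (M i i - l) \<le> 0" for t
    proof -
      have "(\<Sum>j\<in>I. (v j + t * ?e j)\<^sup>2) = (\<Sum>j\<in>I. (v j)\<^sup>2 + 2 * t * (if j = i then v j else 0) + t\<^sup>2 * (?e j)\<^sup>2)"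
        by (intro sum.cong refl) (simp add: power2_eq_square algebra_simps)
      also have "\<dots> = 1 + 2 * t * v i + t\<^sup>2"
        using v fin i sq_unit[OF i] by (simp add: sum.distrib flip: sum_distrib_left)
      finally have "quad_form I M (\<lambda>j. v j + t * ?e j) \<le> l * (1 + 2 * t * v i + t\<^sup>2)"
        using rayleigh[of "\<lambda>j. v j + t * ?e j"] by simp
      then show ?thesis
        unfolding quad_form_add[OF sym] A quad_form_unit[OF fin i] l_def[symmetric]
        by (simp add: algebra_simps)
    qed
    then have "?A - l * v i = 0" by (rule quadratic_nonpos_imp_linear_zero)
    then show ?thesis by simp
  qed
  moreover have "\<exists>i\<in>I. v i \<noteq> 0"
  proof (rule ccontr)
    assume "\<not> ?thesis"
    then show False using v by simp
  qed
  ultimately have "l \<in> mat_eigenvalues I M" by (auto simp: mat_eigenvalues_def)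
  moreover have "M k k \<le> l" using max[OF e] quad_form_unit[OF fin k, of M] by (simp add: l_def)
  ultimately show ?thesis by blast
qed

lemma mat_eigenvalues_uminus:
  "mat_eigenvalues I (\<lambda>i j. - M i j) = uminus ` mat_eigenvalues I M"
proof -
  have "l \<in> mat_eigenvalues I (\<lambda>i j. - M i j) \<longleftrightarrow> - l \<in> mat_eigenvalues I M" for l
  proof -
    have "- s = l * x \<longleftrightarrow> s = - l * x" for s x :: real by auto
    then show ?thesis by (simp add: mat_eigenvalues_def sum_negf)
  qed
  then show ?thesis by (force simp: image_iff)
qed

lemma ex_eigenvalue_le_diag:
  assumes "finite I" "sym_mat I M" "k \<in> I"
  shows "\<exists>l\<in>mat_eigenvalues I M. l \<le> M k k"
  using ex_eigenvalue_ge_diag[of I "\<lambda>i j. - M i j" k] assms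
  by (auto simp: mat_eigenvalues_uminus sym_mat_def)

section \<open>Location and number of the eigenvalues\<close>

lemma quad_form_eigenvector:
  assumes "\<And>i. i \<in> I \<Longrightarrow> (\<Sum>j\<in>I. M i j * v j) = l * v i"
  shows "quad_form I M v = l * (\<Sum>i\<in>I. (v i)\<^sup>2)"
proof -
  have "quad_form I M v = (\<Sum>i\<in>I. v i * (\<Sum>j\<in>I. M i j * v j))"
    by (simp add: quad_form_def sum_distrib_left mult.assoc)
  also have "\<dots> = (\<Sum>i\<in>I. v i * (l * v i))" using assms by simp
  finally show ?thesis by (simp add: sum_distrib_left power2_eq_square ac_simps)
qed

lemma eigenvalue_between:
  assumes "finite I" "\<And>v. lo * (\<Sum>i\<in>I. (v i)\<^sup>2) \<le> quad_form I M v" "\<And>v. quad_form I M v \<le> hi * (\<Sum>i\<in>I. (v i)\<^sup>2)"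
    and "l \<in> mat_eigenvalues I M"
  shows "lo \<le> l" "l \<le> hi"
proof -
  obtain v where v: "\<exists>i\<in>I. v i \<noteq> 0" "\<And>i. i \<in> I \<Longrightarrow> (\<Sum>j\<in>I. M i j * v j) = l * v i"
    using assms(4) by (auto simp: mat_eigenvalues_def)
  have "(\<Sum>i\<in>I. (v i)\<^sup>2) > 0"
    using v(1) assms(1) by (metis (no_types, lifting) sum_pos2 zero_le_power2 zero_less_power2)
  then show "lo \<le> l" "l \<le> hi"
    using assms(2,3)[of v] quad_form_eigenvector[of I M v l, OF v(2)] by simp_all
qed

lemma eigenvectors_orthogonal:
  assumes sym: "sym_mat I M" and "l \<noteq> l'"
    and v: "\<And>i. i \<in> I \<Longrightarrow> (\<Sum>j\<in>I. M i j * v j) = l * v i"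
    and w: "\<And>i. i \<in> I \<Longrightarrow> (\<Sum>j\<in>I. M i j * w j) = l' * w i"
  shows "(\<Sum>i\<in>I. v i * w i) = 0"
proof -
  have "l * (\<Sum>i\<in>I. v i * w i) = (\<Sum>i\<in>I. (\<Sum>j\<in>I. M i j * v j) * w i)"
    by (simp add: v sum_distrib_left mult.assoc)
  also have "\<dots> = (\<Sum>i\<in>I. \<Sum>j\<in>I. M i j * v j * w i)" by (simp add: sum_distrib_right)
  also have "\<dots> = (\<Sum>j\<in>I. \<Sum>i\<in>I. M j i * w i * v j)"
    by (subst sum.swap) (use sym in \<open>auto simp: sym_mat_def intro!: sum.cong\<close>)
  also have "\<dots> = (\<Sum>j\<in>I. (\<Sum>i\<in>I. M j i * w i) * v j)" by (simp add: sum_distrib_right)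
  also have "\<dots> = (\<Sum>j\<in>I. l' * (v j * w j))" by (intro sum.cong refl) (simp add: w)
  also have "\<dots> = l' * (\<Sum>i\<in>I. v i * w i)" by (simp only: sum_distrib_left)
  finally show ?thesis using assms(2) by simp
qed

text \<open>Bessel's inequality for the unit vectors bounds the size of an orthonormal family.\<close>

lemma finite_mat_eigenvalues:
  assumes fin: "finite I" and sym: "sym_mat I M"
  shows "finite (mat_eigenvalues I M)"
proof -
  have "card F \<le> card I" if F: "F \<subseteq> mat_eigenvalues I M" "finite F" for F
  proof -
    have "\<exists>v. (\<forall>i\<in>I. (\<Sum>j\<in>I. M i j * v j) = l * v i) \<and> (\<Sum>i\<in>I. (v i)\<^sup>2) = 1" if l: "l \<in> F" for l
    proof -
      obtain v where v: "\<exists>i\<in>I. v i \<noteq> 0" "\<And>i. i \<in> I \<Longrightarrow> (\<Sum>j\<in>I. M i j * v j) = l * v i"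
        using subsetD[OF F(1) l] by (auto simp: mat_eigenvalues_def)
      define s where "s = (\<Sum>i\<in>I. (v i)\<^sup>2)"
      have s: "s > 0"
        unfolding s_def using v(1) fin by (metis (no_types, lifting) sum_pos2 zero_le_power2 zero_less_power2)
      have "(\<Sum>i\<in>I. (v i / sqrt s)\<^sup>2) = 1"
        using s by (simp add: power_divide flip: sum_divide_distrib s_def)
      moreover have "(\<Sum>j\<in>I. M i j * (v j / sqrt s)) = l * (v i / sqrt s)" if "i \<in> I" for i
        using v(2)[OF that] by (simp flip: sum_divide_distrib)
      ultimately show ?thesis by (intro exI[of _ "\<lambda>i. v i / sqrt s"]) auto
    qed
    then obtain v where ev: "\<And>l i. l \<in> F \<Longrightarrow> i \<in> I \<Longrightarrow> (\<Sum>j\<in>I. M i j * v l j) = l * v l i"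
      and n1: "\<And>l. l \<in> F \<Longrightarrow> (\<Sum>i\<in>I. (v l i)\<^sup>2) = 1"
      by metis
    have orth: "(\<Sum>i\<in>I. v l i * v l' i) = (if l = l' then 1 else 0)" if "l \<in> F" "l' \<in> F" for l l'
      using eigenvectors_orthogonal[OF sym, of l l' "v l" "v l'"] ev n1 that
      by (auto simp: power2_eq_square)
    have bessel: "(\<Sum>l\<in>F. (v l i)\<^sup>2) \<le> 1" if i: "i \<in> I" for i
    proof -
      \<comment> \<open>The orthogonal projection of the \<open>i\<close>-th unit vector onto the
        span of the eigenvectors. Its squared norm equals its \<open>i\<close>-th entry, and
        Bessel's inequality follows from the squared distance to the unit vector being
        nonnegative.\<close>
      define p where "p = (\<lambda>j. \<Sum>l\<in>F. v l i * v l j)"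
      have pp: "(\<Sum>j\<in>I. (p j)\<^sup>2) = (\<Sum>l\<in>F. (v l i)\<^sup>2)"
      proof -
        have "(\<Sum>j\<in>I. (p j)\<^sup>2) = (\<Sum>j\<in>I. \<Sum>l\<in>F. \<Sum>l'\<in>F. v l i * v l' i * (v l j * v l' j))"
          by (simp add: p_def power2_eq_square sum_product ac_simps)
        also have "\<dots> = (\<Sum>l\<in>F. \<Sum>l'\<in>F. \<Sum>j\<in>I. v l i * v l' i * (v l j * v l' j))"
          by (subst sum.swap, intro sum.cong refl, subst sum.swap) simp
        also have "\<dots> = (\<Sum>l\<in>F. \<Sum>l'\<in>F. v l i * v l' i * (if l = l' then 1 else 0))"
          by (intro sum.cong refl) (simp add: orth flip: sum_distrib_left)
        also have "\<dots> = (\<Sum>l\<in>F. (v l i)\<^sup>2)"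
          using F(2) by (simp add: power2_eq_square if_distrib[of "\<lambda>c. _ * c"] cong: if_cong)
        finally show ?thesis .
      qed
      have "0 \<le> (\<Sum>j\<in>I. ((if j = i then 1 else 0) - p j)\<^sup>2)" by (simp add: sum_nonneg)
      also have "\<dots> = (\<Sum>j\<in>I. (if j = i then 1 - 2 * p j else 0) + (p j)\<^sup>2)"
        by (intro sum.cong refl) (simp add: power2_eq_square algebra_simps)
      also have "\<dots> = 1 - 2 * p i + (\<Sum>l\<in>F. (v l i)\<^sup>2)" using fin i by (simp add: sum.distrib pp)
      also have "p i = (\<Sum>l\<in>F. (v l i)\<^sup>2)" by (simp add: p_def power2_eq_square)
      finally show ?thesis by simp
    qed
    \<comment> \<open>Counting the total squared mass of the orthonormal family in two ways: each
      eigenvector contributes 1, each index at most 1.\<close>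
    have "real (card F) = (\<Sum>l\<in>F. \<Sum>i\<in>I. (v l i)\<^sup>2)" by (simp add: n1)
    also have "\<dots> = (\<Sum>i\<in>I. \<Sum>l\<in>F. (v l i)\<^sup>2)" by (rule sum.swap)
    also have "\<dots> \<le> (\<Sum>i\<in>I. 1)" by (intro sum_mono bessel)
    finally show ?thesis by simp
  qed
  then show ?thesis using finite_if_finite_subsets_card_bdd by blast
qed

text \<open>The largest eigenvalue is at least any diagonal entry and the smallest at most any. The
  bound \<open>lo\<close> makes the smallest one positive, so the inequalities may be
  divided.\<close>

lemma cond_number_ge_diag_ratio:
  assumes fin: "finite I" and sym: "sym_mat I M" and i: "i \<in> I" and j: "j \<in> I"
    and lo: "lo > 0" "\<And>v. lo * (\<Sum>i\<in>I. (v i)\<^sup>2) \<le> quad_form I M v"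
    and hi: "\<And>v. quad_form I M v \<le> hi * (\<Sum>i\<in>I. (v i)\<^sup>2)"
  shows "M i i / M j j \<le> cond_number I M"
proof -
  let ?E = "mat_eigenvalues I M"
  have E: "finite ?E" by (rule finite_mat_eigenvalues[OF fin sym])
  obtain l where l: "l \<in> ?E" "M i i \<le> l" using ex_eigenvalue_ge_diag[OF fin sym i] by blast
  obtain l' where l': "l' \<in> ?E" "l' \<le> M j j" using ex_eigenvalue_le_diag[OF fin sym j] by blast
  have "Min ?E \<in> ?E" using E l by (intro Min_in) auto
  then have pos: "0 < Min ?E" using eigenvalue_between(1)[OF fin lo(2) hi] lo(1) by fastforce
  have max: "M i i \<le> Max ?E" using l E by (meson Max_ge order_trans)
  have min: "Min ?E \<le> M j j" using l' E by (meson Min_le order_trans)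
  have "0 \<le> Max ?E" using pos E l by (meson Max_ge Min_le less_le_not_le linorder_le_cases order_trans)
  then show ?thesis unfolding cond_number_def using max min pos by (intro frac_le) auto
qed

lemma cond_number_le:
  assumes fin: "finite I" and ne: "I \<noteq> {}" and sym: "sym_mat I M"
    and lo: "lo > 0" "\<And>v. lo * (\<Sum>i\<in>I. (v i)\<^sup>2) \<le> quad_form I M v"
    and hi: "\<And>v. quad_form I M v \<le> hi * (\<Sum>i\<in>I. (v i)\<^sup>2)"
  shows "cond_number I M \<le> hi / lo"
proof -
  let ?E = "mat_eigenvalues I M"
  have E: "finite ?E" by (rule finite_mat_eigenvalues[OF fin sym])
  have "?E \<noteq> {}" using ex_eigenvalue_ge_diag[OF fin sym] ne by blast
  then have "Min ?E \<in> ?E" "Max ?E \<in> ?E" using E by auto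
  then have "lo \<le> Min ?E" "Max ?E \<le> hi" "lo \<le> Max ?E" using eigenvalue_between[OF fin lo(2) hi] by auto
  then show ?thesis unfolding cond_number_def using lo(1) by (intro frac_le) auto
qed

section \<open>Simplicial meshes\<close>

text \<open>Weights on a face, extended by 0, are weights on the whole vertex set. This lets
  elements sharing a face be compared.\<close>

lemma (in full_simplex) bary_face:
  assumes F: "F \<subseteq> K" and u: "sum u F = 1" "(\<Sum>v\<in>F. u v *\<^sub>R v) = x"
  shows "bary K v x = (if v \<in> F then u v else 0)"
proof (cases "v \<in> K")
  case True
  have KF: "K \<inter> F = F" using F by auto
  show ?thesis
  proof (rule bary_unique[OF _ _ True])
    show "(\<Sum>v\<in>K. if v \<in> F then u v else 0) = 1"
      using u by (simp add: sum.inter_restrict[OF finite_K, symmetric] KF)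
    have "(\<Sum>v\<in>K. (if v \<in> F then u v else 0) *\<^sub>R v) = (\<Sum>v\<in>K. if v \<in> F then u v *\<^sub>R v else 0)"
      by (intro sum.cong) auto
    also have "\<dots> = x" using u by (simp add: sum.inter_restrict[OF finite_K, symmetric] KF)
    finally show "(\<Sum>v\<in>K. (if v \<in> F then u v else 0) *\<^sub>R v) = x" .
  qed
next
  case False
  then show ?thesis using bary_outside F by auto
qed

text \<open>The inequalities come from \<open>1 \<le> H\<close> and \<open>H \<le> d\<close> for the
  harmonic sum. The last identity is the row sum of the local mass matrix of a simplex of unit
  volume.\<close>

lemma m_const_relations:
  assumes "d \<ge> 1"
  shows "m2_const d \<ge> 0" "m1_const d > m2_const d" "m1_const d + real d * m2_const d = 1 / real (d + 1)"
proof -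
  define H where "H = (\<Sum>k=1..d. 1 / real k)"
  define n where "n = real d + 1"
  have d: "real d \<ge> 1" "real d \<noteq> 0" using assms by auto
  have n: "n > 0" by (simp add: n_def)
  have H_le: "H \<le> real d"
  proof -
    have "H \<le> (\<Sum>k=1..d. 1)" unfolding H_def by (intro sum_mono) auto
    then show ?thesis by simp
  qed
  have H_ge: "1 \<le> H"
  proof -
    have "1 / real 1 \<le> H" unfolding H_def using assms by (intro member_le_sum) auto
    then show ?thesis by simp
  qed
  have m1: "m1_const d = (1 + n * H) / n ^ 3" by (simp add: m1_const_def H_def n_def add.commute)
  have m2: "m2_const d = ((real d)\<^sup>2 + 2 * real d - n * H) / (real d * n ^ 3)"
    by (simp add: m2_const_def H_def n_def add.commute)
  have "n * H \<le> n * real d" using H_le n by (intro mult_left_mono) auto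
  then have "(real d)\<^sup>2 + 2 * real d - n * H \<ge> 0" using d by (simp add: n_def power2_eq_square algebra_simps)
  then show "m2_const d \<ge> 0" unfolding m2 using n by simp
  have m1': "m1_const d = real d * (1 + n * H) / (real d * n ^ 3)" unfolding m1 using d by simp
  have "n * n \<le> n * n * H" using H_ge n by simp
  then have "(real d)\<^sup>2 + 2 * real d - n * H < real d * (1 + n * H)"
    using d by (simp add: n_def power2_eq_square algebra_simps)
  then show "m1_const d > m2_const d" unfolding m1' m2 using n d by (intro divide_strict_right_mono) auto
  have "m1_const d + real d * m2_const d = (1 + n * H) / n ^ 3 + ((real d)\<^sup>2 + 2 * real d - n * H) / n ^ 3"
    unfolding m1 m2 using d by simp
  also have "\<dots> = n\<^sup>2 / n ^ 3"
    by (simp add: n_def power2_eq_square algebra_simps flip: add_divide_distrib)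
  finally show "m1_const d + real d * m2_const d = 1 / real (d + 1)"
    using n by (simp add: power2_eq_square power3_eq_cube n_def add.commute)
qed

locale mesh =
  fixes T :: "'a::euclidean_space set set"
  assumes simplicial_mesh: "simplicial_mesh T"
begin

lemma finite_T: "finite T"
  using simplicial_mesh by (simp add: simplicial_mesh_def)

lemma full_simplex: "K \<in> T \<Longrightarrow> full_simplex K"
  using simplicial_mesh by unfold_locales (auto simp: simplicial_mesh_def)

lemma hull_Int: "K \<in> T \<Longrightarrow> K' \<in> T \<Longrightarrow> convex hull K \<inter> convex hull K' = convex hull (K \<inter> K')"
  using simplicial_mesh by (simp add: simplicial_mesh_def)

lemma common_face_combination:
  assumes "K \<in> T" "K' \<in> T" "x \<in> convex hull K" "x \<in> convex hull K'"
  obtains u where "sum u (K \<inter> K') = 1" "(\<Sum>v\<in>K \<inter> K'. u v *\<^sub>R v) = x"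
proof -
  have "x \<in> convex hull (K \<inter> K')" using hull_Int assms by blast
  moreover have "finite (K \<inter> K')" using full_simplex.finite_K[OF full_simplex[OF assms(1)]] by simp
  ultimately show thesis using that by (auto simp: convex_hull_finite)
qed

text \<open>Conformity places \<open>x\<close> in the hull of the common vertices, and both elements
  then extend the same face weights by 0.\<close>

lemma bary_agree:
  assumes "K \<in> T" "K' \<in> T" "x \<in> convex hull K" "x \<in> convex hull K'"
  shows "bary K v x = bary K' v x"
proof -
  obtain u where u: "sum u (K \<inter> K') = 1" "(\<Sum>v\<in>K \<inter> K'. u v *\<^sub>R v) = x"
    using common_face_combination[OF assms] .
  show ?thesis
    using full_simplex.bary_face[OF full_simplex[OF assms(1)] _ u] full_simplex.bary_face[OF full_simplex[OF assms(2)] _ u]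
    by simp
qed

text \<open>The element picked by \<open>SOME\<close> is irrelevant because coordinates agree on
  common faces. In the default case \<open>Q\<close> is not a vertex of \<open>K\<close>, so both
  sides are 0.\<close>

lemma hat_fun_eq_bary:
  assumes K: "K \<in> T" "x \<in> convex hull K"
  shows "hat_fun T Q x = bary K Q x"
proof (cases "\<exists>K'\<in>T. Q \<in> K' \<and> x \<in> convex hull K'")
  case True
  let ?K' = "SOME K'. K' \<in> T \<and> Q \<in> K' \<and> x \<in> convex hull K'"
  have "?K' \<in> T \<and> Q \<in> ?K' \<and> x \<in> convex hull ?K'" by (rule someI_ex) (use True in blast)
  then show ?thesis using True bary_agree[of ?K' K x Q] K by (simp add: hat_fun_def)
next
  case False
  then have "Q \<notin> K" using K by blast
  then show ?thesis using False full_simplex.bary_outside[OF full_simplex[OF K(1)]] by (auto simp: hat_fun_def)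
qed

text \<open>Distinct elements have equally many vertices, so \<open>K\<close> has a vertex outside
  \<open>K'\<close>; its coordinate vanishes on the intersection, which therefore lies in a
  hyperplane.\<close>

lemma negligible_hull_Int:
  assumes "K \<in> T" "K' \<in> T" "K \<noteq> K'"
  shows "negligible (convex hull K \<inter> convex hull K')"
proof -
  interpret K: full_simplex K by (rule full_simplex) fact
  interpret K': full_simplex K' by (rule full_simplex) fact
  have "\<not> K \<subseteq> K'" using card_subset_eq[OF K'.finite_K, of K] K.card_K K'.card_K assms(3) by auto
  then obtain v where v: "v \<in> K" "v \<notin> K'" by blast
  have "bary K v x = 0" if "x \<in> convex hull K \<inter> convex hull K'" for x
    using that bary_agree[OF assms(1,2), of x v] K'.bary_outside[OF v(2)] by simp
  then show ?thesis using negligible_subset[OF K.negligible_bary_zero[OF v(1)]] by blast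
qed

lemma measure_patch:
  "measure lebesgue (patch T P) = (\<Sum>K\<in>{K\<in>T. P \<in> K}. measure lebesgue (convex hull K))"
proof -
  have c: "compact (convex hull K)" if "K \<in> T" for K
    using full_simplex.compact_hull[OF full_simplex[OF that]] .
  have "compact (patch T P)" unfolding patch_def using finite_T c by (intro compact_UN) auto
  then have "measure lebesgue (patch T P) = integral (patch T P) (\<lambda>x. 1)"
    by (intro lmeasure_integral lmeasurable_compact)
  also have "\<dots> = (\<Sum>K\<in>{K\<in>T. P \<in> K}. integral (convex hull K) (\<lambda>x. 1))"
    unfolding patch_def
  proof (rule integral_UN_negligible)
    fix K assume "K \<in> {K\<in>T. P \<in> K}"
    then show "(\<lambda>x. 1::real) integrable_on convex hull K"
      by (intro integrable_continuous_compact c) auto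
  qed (use finite_T negligible_hull_Int in auto)
  also have "\<dots> = (\<Sum>K\<in>{K\<in>T. P \<in> K}. measure lebesgue (convex hull K))"
    by (intro sum.cong refl full_simplex.integral_one_hull full_simplex) auto
  finally show ?thesis .
qed

text \<open>The pieces of the dual cell overlap in null sets, so an entry is a sum of local entries.
  Elements without \<open>Q\<close> drop out since the hat function of \<open>Q\<close> vanishes
  there.\<close>

lemma fvem_mass_eq:
  "fvem_mass T P Q = (\<Sum>K\<in>{K\<in>T. P \<in> K \<and> Q \<in> K}.
     measure lebesgue (convex hull K) * (if P = Q then m1_const DIM('a) else m2_const DIM('a)))"
proof -
  let ?TP = "{K\<in>T. P \<in> K}"
  let ?C = "\<lambda>K. {x \<in> convex hull K. \<forall>Q\<in>K. bary K Q x \<le> bary K P x}"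
  have cell: "?C K = full_simplex.cell K P" if "K \<in> T" for K
    using full_simplex.cell_def[OF full_simplex[OF that]] by simp
  have hat: "integral (?C K) (hat_fun T Q) = integral (?C K) (bary K Q)" if "K \<in> T" for K
    by (rule integral_cong) (use that hat_fun_eq_bary in auto)
  have "fvem_mass T P Q = (\<Sum>K\<in>?TP. integral (?C K) (hat_fun T Q))"
    unfolding fvem_mass_def dual_cell_def
  proof (rule integral_UN_negligible)
    fix K assume "K \<in> ?TP"
    then have K: "K \<in> T" by simp
    interpret K: full_simplex K by (rule full_simplex[OF K])
    have "bary K Q integrable_on ?C K"
      unfolding cell[OF K] by (intro integrable_continuous_compact K.compact_cell K.continuous_on_bary)
    then show "hat_fun T Q integrable_on ?C K"
      by (rule integrable_eq) (use hat_fun_eq_bary[OF K] in auto)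
  next
    fix K K' assume "K \<in> ?TP" "K' \<in> ?TP" "K \<noteq> K'"
    then have "negligible (convex hull K \<inter> convex hull K')" by (intro negligible_hull_Int) auto
    then show "negligible (?C K \<inter> ?C K')" by (rule negligible_subset) auto
  qed (use finite_T in auto)
  also have "\<dots> = (\<Sum>K\<in>?TP. if Q \<in> K then measure lebesgue (convex hull K) *
      (if P = Q then m1_const DIM('a) else m2_const DIM('a)) else 0)"
  proof (intro sum.cong refl)
    fix K assume "K \<in> ?TP"
    then have K: "K \<in> T" "P \<in> K" by auto
    interpret K: full_simplex K by (rule full_simplex[OF K(1)])
    show "integral (?C K) (hat_fun T Q) = (if Q \<in> K then measure lebesgue (convex hull K) *
      (if P = Q then m1_const DIM('a) else m2_const DIM('a)) else 0)"
    proof (cases "Q \<in> K")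
      case True
      then show ?thesis unfolding hat[OF K(1)] unfolding cell[OF K(1)]
        using K.integral_cell_diag[OF K(2)] K.integral_cell_offdiag[OF K(2) True] by auto
    next
      case False
      then have "bary K Q = (\<lambda>_. 0)" by (simp add: K.bary_outside fun_eq_iff)
      then show ?thesis unfolding hat[OF K(1)] using False by simp
    qed
  qed
  also have "\<dots> = (\<Sum>K\<in>{K\<in>?TP. Q \<in> K}. measure lebesgue (convex hull K) *
      (if P = Q then m1_const DIM('a) else m2_const DIM('a)))"
    by (rule sum.inter_filter[symmetric]) (use finite_T in simp)
  finally show ?thesis by (simp add: conj_assoc)
qed

lemma fvem_mass_diag: "fvem_mass T P P = m1_const DIM('a) * measure lebesgue (patch T P)"
  by (simp add: fvem_mass_eq measure_patch sum_distrib_left mult.commute)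

lemma sym_fvem_mass: "sym_mat I (fvem_mass T)"
  unfolding sym_mat_def by (auto simp: fvem_mass_eq intro!: sum.cong)

section \<open>The quadratic form of the mass matrix, assembled element by element\<close>

lemma sum_patches:
  assumes "finite I"
  shows "(\<Sum>K\<in>T. measure lebesgue (convex hull K) * (\<Sum>P\<in>I \<inter> K. f P)) = (\<Sum>P\<in>I. measure lebesgue (patch T P) * f P)"
proof -
  have "(\<Sum>K\<in>T. measure lebesgue (convex hull K) * (\<Sum>P\<in>I \<inter> K. f P))
      = (\<Sum>K\<in>T. \<Sum>P\<in>I. if P \<in> K then measure lebesgue (convex hull K) * f P else 0)"
    unfolding sum_distrib_left sum.inter_restrict[OF assms] by (intro sum.cong refl) auto
  also have "\<dots> = (\<Sum>P\<in>I. \<Sum>K\<in>T. if P \<in> K then measure lebesgue (convex hull K) * f P else 0)"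
    by (rule sum.swap)
  also have "\<dots> = (\<Sum>P\<in>I. measure lebesgue (patch T P) * f P)"
    unfolding measure_patch sum_distrib_right sum.inter_filter[OF finite_T] by (intro sum.cong refl) auto
  finally show ?thesis .
qed

text \<open>Each local matrix is a multiple of the identity plus \<open>m2_const\<close> times the
  all-ones matrix, whose form is the square of the sum of entries. Only the vertices of
  \<open>K\<close> in \<open>I\<close> carry unknowns, hence the sums over
  \<open>I \<inter> K\<close>.\<close>

lemma quad_form_fvem_mass:
  assumes I: "finite I"
  shows "quad_form I (fvem_mass T) v = (\<Sum>K\<in>T. measure lebesgue (convex hull K) *
    ((m1_const DIM('a) - m2_const DIM('a)) * (\<Sum>P\<in>I \<inter> K. (v P)\<^sup>2) + m2_const DIM('a) * (\<Sum>P\<in>I \<inter> K. v P)\<^sup>2))"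
proof -
  let ?m1 = "m1_const DIM('a)" and ?m2 = "m2_const DIM('a)"
  let ?w = "\<lambda>K. measure lebesgue (convex hull K)"
  have loc: "(\<Sum>P\<in>I. if P \<in> K then (\<Sum>Q\<in>I. if Q \<in> K then v P * (if P = Q then ?m1 else ?m2) * v Q else 0) else 0)
      = (?m1 - ?m2) * (\<Sum>P\<in>I \<inter> K. (v P)\<^sup>2) + ?m2 * (\<Sum>P\<in>I \<inter> K. v P)\<^sup>2" for K
  proof -
    have "(\<Sum>P\<in>I. if P \<in> K then (\<Sum>Q\<in>I. if Q \<in> K then v P * (if P = Q then ?m1 else ?m2) * v Q else 0) else 0)
      = (\<Sum>P\<in>I \<inter> K. \<Sum>Q\<in>I \<inter> K. v P * (if P = Q then ?m1 else ?m2) * v Q)"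
      by (simp only: sum.inter_restrict[OF I])
    also have "\<dots> = (\<Sum>P\<in>I \<inter> K. \<Sum>Q\<in>I \<inter> K. (if P = Q then (?m1 - ?m2) * (v P)\<^sup>2 else 0) + ?m2 * (v P * v Q))"
      by (intro sum.cong refl) (simp add: power2_eq_square algebra_simps)
    also have "\<dots> = (\<Sum>P\<in>I \<inter> K. (?m1 - ?m2) * (v P)\<^sup>2) + ?m2 * (\<Sum>P\<in>I \<inter> K. \<Sum>Q\<in>I \<inter> K. v P * v Q)"
      using I by (simp add: sum.distrib sum_distrib_left)
    also have "\<dots> = (?m1 - ?m2) * (\<Sum>P\<in>I \<inter> K. (v P)\<^sup>2) + ?m2 * (\<Sum>P\<in>I \<inter> K. v P)\<^sup>2"
      unfolding power2_eq_square[of "sum v (I \<inter> K)"] sum_product by (simp only: sum_distrib_left)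
    finally show ?thesis .
  qed
  have entry: "v P * fvem_mass T P Q * v Q
      = (\<Sum>K\<in>T. ?w K * (if P \<in> K then if Q \<in> K then v P * (if P = Q then ?m1 else ?m2) * v Q else 0 else 0))" for P Q
  proof -
    have "v P * fvem_mass T P Q * v Q
       = (\<Sum>K\<in>{K\<in>T. P \<in> K \<and> Q \<in> K}. ?w K * (v P * (if P = Q then ?m1 else ?m2) * v Q))"
      by (simp add: fvem_mass_eq sum_distrib_left sum_distrib_right ac_simps)
    also have "\<dots> = (\<Sum>K\<in>T. if P \<in> K \<and> Q \<in> K then ?w K * (v P * (if P = Q then ?m1 else ?m2) * v Q) else 0)"
      by (rule sum.inter_filter[OF finite_T])
    also have "\<dots> = (\<Sum>K\<in>T. ?w K * (if P \<in> K then if Q \<in> K then v P * (if P = Q then ?m1 else ?m2) * v Q else 0 else 0))"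
      by (intro sum.cong refl) simp
    finally show ?thesis .
  qed
  have "quad_form I (fvem_mass T) v = (\<Sum>P\<in>I. \<Sum>Q\<in>I. \<Sum>K\<in>T. ?w K * (if P \<in> K then if Q \<in> K then v P * (if P = Q then ?m1 else ?m2) * v Q else 0 else 0))"
    unfolding quad_form_def entry ..
  also have "\<dots> = (\<Sum>K\<in>T. \<Sum>P\<in>I. \<Sum>Q\<in>I. ?w K * (if P \<in> K then if Q \<in> K then v P * (if P = Q then ?m1 else ?m2) * v Q else 0 else 0))"
    by (subst (2) sum.swap, subst sum.swap) simp
  also have "\<dots> = (\<Sum>K\<in>T. ?w K * (\<Sum>P\<in>I. if P \<in> K then (\<Sum>Q\<in>I. if Q \<in> K then v P * (if P = Q then ?m1 else ?m2) * v Q else 0) else 0))"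
    unfolding sum_distrib_left by (intro sum.cong refl) (auto simp: sum_distrib_left)
  finally show ?thesis unfolding loc .
qed

text \<open>The squared sums have nonnegative weight and are dropped; regrouping the rest by
  vertices produces the patch volumes.\<close>

lemma quad_form_lower:
  assumes I: "finite I"
  shows "(m1_const DIM('a) - m2_const DIM('a)) * (\<Sum>P\<in>I. measure lebesgue (patch T P) * (v P)\<^sup>2) \<le> quad_form I (fvem_mass T) v"
proof -
  have "(m1_const DIM('a) - m2_const DIM('a)) * (\<Sum>P\<in>I. measure lebesgue (patch T P) * (v P)\<^sup>2)
     = (\<Sum>K\<in>T. measure lebesgue (convex hull K) * ((m1_const DIM('a) - m2_const DIM('a)) * (\<Sum>P\<in>I \<inter> K. (v P)\<^sup>2)))"
    unfolding sum_patches[OF I, symmetric] sum_distrib_left[of _ _ T] by (simp add: ac_simps)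
  also have "\<dots> \<le> quad_form I (fvem_mass T) v"
    unfolding quad_form_fvem_mass[OF I]
    by (intro sum_mono mult_left_mono) (use m_const_relations(1)[of "DIM('a)"] DIM_positive[where 'a='a] in \<open>auto simp: Suc_leI\<close>)
  finally show ?thesis .
qed

text \<open>Cauchy-Schwarz bounds the squared sum by the number of vertices in
  \<open>I \<inter> K\<close>, at most \<open>d + 1\<close>, times the sum of squares. The
  coefficient becomes \<open>m1 + d m2\<close>, the row sum \<open>1 / (d + 1)\<close>.\<close>

lemma quad_form_upper:
  assumes I: "finite I"
  shows "quad_form I (fvem_mass T) v \<le> 1 / (DIM('a) + 1) * (\<Sum>P\<in>I. measure lebesgue (patch T P) * (v P)\<^sup>2)"
proof -
  let ?m1 = "m1_const DIM('a)" and ?m2 = "m2_const DIM('a)"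
  have d: "DIM('a) \<ge> 1" by (simp add: Suc_leI)
  have le: "(?m1 - ?m2) * (\<Sum>P\<in>I \<inter> K. (v P)\<^sup>2) + ?m2 * (\<Sum>P\<in>I \<inter> K. v P)\<^sup>2
      \<le> 1 / (DIM('a) + 1) * (\<Sum>P\<in>I \<inter> K. (v P)\<^sup>2)" if "K \<in> T" for K
  proof -
    interpret full_simplex K by (rule full_simplex[OF that])
    have "(\<Sum>P\<in>I \<inter> K. v P)\<^sup>2 \<le> card (I \<inter> K) * (\<Sum>P\<in>I \<inter> K. (v P)\<^sup>2)"
      using Cauchy_Schwarz_ineq_sum[of "\<lambda>_. 1" v "I \<inter> K"] by simp
    also have "\<dots> \<le> (DIM('a) + 1) * (\<Sum>P\<in>I \<inter> K. (v P)\<^sup>2)"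
      using card_mono[OF finite_K, of "I \<inter> K"] card_K by (intro mult_right_mono sum_nonneg) auto
    finally have "?m2 * (\<Sum>P\<in>I \<inter> K. v P)\<^sup>2 \<le> ?m2 * ((DIM('a) + 1) * (\<Sum>P\<in>I \<inter> K. (v P)\<^sup>2))"
      using m_const_relations(1)[OF d] by (intro mult_left_mono) auto
    then have "(?m1 - ?m2) * (\<Sum>P\<in>I \<inter> K. (v P)\<^sup>2) + ?m2 * (\<Sum>P\<in>I \<inter> K. v P)\<^sup>2
      \<le> (?m1 + DIM('a) * ?m2) * (\<Sum>P\<in>I \<inter> K. (v P)\<^sup>2)"
      by (simp add: algebra_simps)
    then show ?thesis unfolding m_const_relations(3)[OF d] by simp
  qed
  have "quad_form I (fvem_mass T) v \<le> (\<Sum>K\<in>T. measure lebesgue (convex hull K) * (1 / (DIM('a) + 1) * (\<Sum>P\<in>I \<inter> K. (v P)\<^sup>2)))"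
    unfolding quad_form_fvem_mass[OF I] by (intro sum_mono mult_left_mono le) auto
  also have "\<dots> = 1 / (DIM('a) + 1) * (\<Sum>P\<in>I. measure lebesgue (patch T P) * (v P)\<^sup>2)"
    unfolding sum_patches[OF I, symmetric] sum_distrib_left[of _ _ T] by (simp add: ac_simps)
  finally show ?thesis .
qed

lemma patch_pos:
  assumes "P \<in> \<Union>T"
  shows "measure lebesgue (patch T P) > 0"
proof -
  obtain K where K: "K \<in> T" "P \<in> K" using assms by blast
  show ?thesis
    unfolding measure_patch
    by (rule sum_pos2[of _ K]) (use K finite_T full_simplex.vol_pos[OF full_simplex] in auto)
qed

end

section \<open>Definiteness and condition number from the patch volumes\<close>

theorem mainTheorem13:
  fixes T :: "'a::euclidean_space set set"
  assumes "simplicial_mesh T"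
    and "connected (mesh_domain T)"
    and "interior_vertices T \<noteq> {}"
  defines "I \<equiv> interior_vertices T"
    and "M \<equiv> fvem_mass T"
    and "d \<equiv> DIM('a)"
    and "wmax \<equiv> Max ((\<lambda>P. measure lebesgue (patch T P)) ` interior_vertices T)"
    and "wmin \<equiv> Min ((\<lambda>P. measure lebesgue (patch T P)) ` interior_vertices T)"
  shows "sym_mat I M \<and> pos_def_mat I M \<and>
         wmax / wmin \<le> cond_number I M \<and>
         cond_number I M \<le> 1 / (real (d+1) * (m1_const d - m2_const d)) * (wmax / wmin)"
proof -
  interpret mesh T by unfold_locales fact
  let ?w = "\<lambda>P. measure lebesgue (patch T P)"
  \<comment> \<open>Bounds for the Rayleigh quotient obtained by replacing every patch volume by the
    extreme one; \<open>?hi / ?lo\<close> is the claimed upper bound.\<close>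
  let ?lo = "(m1_const d - m2_const d) * wmin"
  let ?hi = "1 / real (d + 1) * wmax"
  have d: "d \<ge> 1" by (simp add: d_def Suc_leI)
  have "finite (\<Union>T)"
    using finite_T full_simplex.finite_K[OF full_simplex] by (intro finite_Union) auto
  then have I: "finite I" "I \<noteq> {}" "I \<subseteq> \<Union>T"
    using assms(3) finite_subset[of I "\<Union>T"] by (auto simp: I_def interior_vertices_def)
  have w_le: "?w P \<le> wmax" "wmin \<le> ?w P" if "P \<in> I" for P
    using that I by (auto simp: wmax_def wmin_def I_def)
  have "wmax \<in> ?w ` I" "wmin \<in> ?w ` I"
    unfolding wmax_def wmin_def I_def[symmetric] using I by (auto intro!: Max_in Min_in)
  \<comment> \<open>Vertices with the largest and the smallest patch. The factor
    \<open>m1_const d\<close> cancels in the ratio of their diagonal entries, leaving exactly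
    \<open>wmax / wmin\<close>.\<close>
  then obtain P Q where P: "P \<in> I" "wmax = ?w P" and Q: "Q \<in> I" "wmin = ?w Q" by auto
  have wmin_pos: "wmin > 0" using patch_pos[of Q] Q I by auto
  have lo_pos: "?lo > 0" using m_const_relations(2)[OF d] wmin_pos by simp
  have lo: "?lo * (\<Sum>i\<in>I. (v i)\<^sup>2) \<le> quad_form I M v" for v
  proof -
    have "wmin * (\<Sum>i\<in>I. (v i)\<^sup>2) \<le> (\<Sum>i\<in>I. ?w i * (v i)\<^sup>2)"
      unfolding sum_distrib_left by (intro sum_mono mult_right_mono w_le) auto
    then have "(m1_const d - m2_const d) * (wmin * (\<Sum>i\<in>I. (v i)\<^sup>2)) \<le> (m1_const d - m2_const d) * (\<Sum>i\<in>I. ?w i * (v i)\<^sup>2)"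
      using m_const_relations(2)[OF d] by (intro mult_left_mono) auto
    then show ?thesis using quad_form_lower[OF I(1), of v] by (simp add: M_def d_def mult.assoc)
  qed
  have hi: "quad_form I M v \<le> ?hi * (\<Sum>i\<in>I. (v i)\<^sup>2)" for v
  proof -
    have "(\<Sum>i\<in>I. ?w i * (v i)\<^sup>2) \<le> wmax * (\<Sum>i\<in>I. (v i)\<^sup>2)"
      unfolding sum_distrib_left by (intro sum_mono mult_right_mono w_le) auto
    then have "1 / real (d + 1) * (\<Sum>i\<in>I. ?w i * (v i)\<^sup>2) \<le> 1 / real (d + 1) * (wmax * (\<Sum>i\<in>I. (v i)\<^sup>2))"
      by (intro mult_left_mono) auto
    then show ?thesis using quad_form_upper[OF I(1), of v] unfolding M_def d_def mult.assoc
      by (rule order_trans[rotated])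
  qed
  have sym: "sym_mat I M" unfolding M_def by (rule sym_fvem_mass)
  have "pos_def_mat I M"
    unfolding pos_def_mat_def
  proof (intro allI impI)
    fix v :: "'a \<Rightarrow> real" assume "\<exists>i\<in>I. v i \<noteq> 0"
    then have "0 < (\<Sum>i\<in>I. (v i)\<^sup>2)"
      using I(1) by (metis (no_types, lifting) sum_pos2 zero_le_power2 zero_less_power2)
    then have "0 < ?lo * (\<Sum>i\<in>I. (v i)\<^sup>2)" using lo_pos by (rule mult_pos_pos[rotated])
    then show "0 < (\<Sum>i\<in>I. \<Sum>j\<in>I. v i * M i j * v j)"
      using lo[of v] unfolding quad_form_def by linarith
  qed
  moreover have "wmax / wmin \<le> cond_number I M"
  proof -
    have "m1_const d > 0" using m_const_relations(1,2)[OF d] by linarith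
    then have "wmax / wmin = M P P / M Q Q" by (simp add: M_def fvem_mass_diag P Q d_def)
    also have "\<dots> \<le> cond_number I M"
      by (rule cond_number_ge_diag_ratio[OF I(1) sym P(1) Q(1) lo_pos lo hi])
    finally show ?thesis .
  qed
  moreover have "cond_number I M \<le> 1 / (real (d+1) * (m1_const d - m2_const d)) * (wmax / wmin)"
    using cond_number_le[OF I(1,2) sym lo_pos lo hi] by simp
  ultimately show ?thesis using sym by blast
qed

end
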